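(* For $\frac12<c<1$, let $K_c=I_1\cup I_2\cup I_3\cup I_4$, where $$I_1=[1,2c],\quad I_2=[2c+2,c+3],\quad I_3=\left[c,\tfrac{c+1}{2}\right],\quad I_4=\left[\tfrac{c+3}{2},2\right].$$ Then $K_c$ is an $H^2$-wavelet set.
   Context: Fourier transform: $\widehat f(\xi)=\int_{\mathbb R}f(x)e^{-2\pi i x\xi}\,dx$; $\mathbb R^+=(0,\infty)$. $H^2(\mathbb R)=\{f\in L^2(\mathbb R):\widehat f(\xi)=0\text{ for a.e. }\xi\le 0\}$. A function $\psi\in H^2(\mathbb R)$ is an $H^2$-wavelet if $\{2^{j/2}\psi(2^j\cdot-k):j,k\in\mathbb Z\}$ is an orthonormal basis of $H^2(\mathbb R)$. A measurable set $K\subset\mathbb R^+$ is an $H^2$-wavelet set if there is an $H^2$-wavelet $\psi$ with $|\widehat\psi|=\chi_K$ a.e. *)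

theory Defs
  imports "HOL-Analysis.Analysis"
begin

text \<open>
  Elements of \<open>L\<^sup>2(\<real>)\<close> are represented by functions rather than by classes modulo
  almost-everywhere equality; all notions below depend only on the class.
\<close>

definition square_integrable :: "(real \<Rightarrow> complex) set" where
  "square_integrable =
     {f \<in> borel_measurable lebesgue. integrable lebesgue (\<lambda>x. (cmod (f x))\<^sup>2)}"

definition l2_inner :: "(real \<Rightarrow> complex) \<Rightarrow> (real \<Rightarrow> complex) \<Rightarrow> complex" where
  "l2_inner f g = (LINT x|lebesgue. f x * cnj (g x))"

definition l2_norm :: "(real \<Rightarrow> complex) \<Rightarrow> real" where
  "l2_norm f = sqrt (LINT x|lebesgue. (cmod (f x))\<^sup>2)"

definition fourier_integral :: "(real \<Rightarrow> complex) \<Rightarrow> real \<Rightarrow> complex" where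
  "fourier_integral f \<xi> =
     (LINT x|lebesgue. f x * exp (- 2 * complex_of_real pi * \<i> * complex_of_real x * complex_of_real \<xi>))"

text \<open>
  The integral above need not converge absolutely for square-integrable \<open>f\<close>. As usual, the Fourier
  transform of such \<open>f\<close> is the \<open>L\<^sup>2\<close> limit of the Fourier integrals of its truncations to
  \<open>[-n, n]\<close>, which is determined up to a null set; hence it is a relation here.
  The nonnegative integral is used because, unlike the Bochner integral, it does not vanish
  on non-integrable functions.
\<close>

definition has_fourier_transform :: "(real \<Rightarrow> complex) \<Rightarrow> (real \<Rightarrow> complex) \<Rightarrow> bool" where
  "has_fourier_transform f g \<longleftrightarrow>
     f \<in> square_integrable \<and> g \<in> square_integrable \<and>
     ((\<lambda>n::nat. \<integral>\<^sup>+ \<xi>. ennreal ((cmod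
         (fourier_integral (\<lambda>x. indicator {- real n..real n} x * f x) \<xi> - g \<xi>))\<^sup>2) \<partial>lebesgue)
       \<longlonglongrightarrow> 0)"

definition hardy_space :: "(real \<Rightarrow> complex) set" where
  "hardy_space =
     {f \<in> square_integrable.
        \<exists>g. has_fourier_transform f g \<and> (AE \<xi> in lebesgue. \<xi> \<le> 0 \<longrightarrow> g \<xi> = 0)}"

definition orthonormal_basis_of ::
  "(real \<Rightarrow> complex) set \<Rightarrow> ('i \<Rightarrow> real \<Rightarrow> complex) \<Rightarrow> bool" where
  "orthonormal_basis_of V e \<longleftrightarrow>
     (\<forall>i. e i \<in> V) \<and>
     (\<forall>i i'. l2_inner (e i) (e i') = (if i = i' then 1 else 0)) \<and>
     (\<forall>f\<in>V. \<forall>\<epsilon>>0. \<exists>F a. finite F \<and> l2_norm (\<lambda>x. f x - (\<Sum>i\<in>F. a i * e i x)) < \<epsilon>)"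

definition wavelet_system :: "(real \<Rightarrow> complex) \<Rightarrow> int \<times> int \<Rightarrow> real \<Rightarrow> complex" where
  "wavelet_system \<psi> = (\<lambda>(j, k) x.
     complex_of_real (2 powr (real_of_int j / 2)) * \<psi> (2 powi j * x - real_of_int k))"

definition H2_wavelet :: "(real \<Rightarrow> complex) \<Rightarrow> bool" where
  "H2_wavelet \<psi> \<longleftrightarrow>
     \<psi> \<in> hardy_space \<and> orthonormal_basis_of hardy_space (wavelet_system \<psi>)"

definition H2_wavelet_set :: "real set \<Rightarrow> bool" where
  "H2_wavelet_set K \<longleftrightarrow>
     K \<in> sets lebesgue \<and> K \<subseteq> {0<..} \<and>
     (\<exists>\<psi> g. H2_wavelet \<psi> \<and> has_fourier_transform \<psi> g \<and>
        (AE \<xi> in lebesgue. cmod (g \<xi>) = indicator K \<xi>))"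

end

theory Submission
  imports Defs
begin

text \<open>
  A bounded measurable set \<open>K\<close> of positive numbers is an \<open>H\<^sup>2\<close>-wavelet set as soon as, up to null sets, its
  integer translates tile the line and its dyadic dilates tile the positive half-line
  (\<open>H2_wavelet_set_if_tiles\<close>).  The wavelet is the inverse Fourier transform of the indicator
  of \<open>K\<close>.  On the frequency side the wavelet with indices \<open>j\<close> and \<open>k\<close> is a normalized exponential
  restricted to \<open>2\<^sup>j K\<close>.  For fixed \<open>j\<close> these exponentials satisfy Parseval's identity on \<open>2\<^sup>j K\<close>,
  because folding \<open>K\<close> onto the unit interval by integer translations reduces the claim to Fourier
  series (\<open>Parseval_translation_tile\<close>); summing over \<open>j\<close> gives Parseval's identity for all
  functions on the positive half-line (\<open>Parseval_wavelet_frequency\<close>).  A system of unit vectors of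
  the space that satisfies Parseval's identity is automatically an orthonormal basis, since
  Parseval's identity for one of the vectors leaves no room for inner products with the others.

  Passing between space and frequency needs the \<open>L\<^sup>2\<close> theory of the Fourier transform, and this
  too comes from Fourier series.  Trigonometric polynomials are dense in \<open>L\<^sup>2[0, 1]\<close> by the
  Stone--Weierstrass theorem (\<open>trig_approximable_square_integrable\<close>), whence Parseval's identity
  on the unit interval.  If \<open>f\<close> lives on the unit interval, that identity evaluates the sum of
  \<open>|F f (\<xi> + k)|\<^sup>2\<close> over the integers \<open>k\<close> for each \<open>\<xi>\<close>; integrating over \<open>0 \<le> \<xi> < 1\<close> gives
  Plancherel's theorem (\<open>Plancherel_unit_interval\<close>).  Plancherel and Fubini
  (\<open>fourier_integral_adjoint\<close>) then show that an inverse transform of a compactly supported function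
  has that function as its Fourier transform (\<open>has_fourier_transform_inverse_fourier\<close>), and that
  Fourier transforms preserve norms and the inner products with the wavelets
  (\<open>has_fourier_transform_Plancherel\<close>).

  What remains is the arithmetic of the four intervals.  Integer translations rearrange them into
  \<open>[0, 1]\<close> (\<open>translation_tile_K\<close>) and dyadic dilations rearrange them into \<open>[1, 2]\<close>
  (\<open>dilation_tile_K\<close>), in both cases overlapping only at endpoints.
\<close>

section \<open>The inner product of square-integrable functions\<close>

lemma square_integrable_measurable [measurable_dest]:
  "f \<in> square_integrable \<Longrightarrow> f \<in> borel_measurable lebesgue"
  by (simp add: square_integrable_def)

lemma square_integrable_integrable:
  "f \<in> square_integrable \<Longrightarrow> integrable lebesgue (\<lambda>x. (cmod (f x))\<^sup>2)"
  by (simp add: square_integrable_def)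

lemma borel_measurable_cnj [measurable (raw)]:
  "f \<in> borel_measurable M \<Longrightarrow> (\<lambda>x. cnj (f x)) \<in> borel_measurable M"
  by (rule borel_measurable_continuous_on[where f = cnj]) (auto intro!: continuous_intros)

lemma square_integrableI_bound:
  assumes "f \<in> borel_measurable lebesgue" "integrable lebesgue g"
    and "\<And>x. (cmod (f x))\<^sup>2 \<le> g x"
  shows "f \<in> square_integrable"
proof -
  have "integrable lebesgue (\<lambda>x. (cmod (f x))\<^sup>2)"
    by (rule Bochner_Integration.integrable_bound[OF assms(2)])
       (use assms(1,3) order_trans[OF assms(3) abs_ge_self] in
         \<open>auto intro!: always_eventually\<close>)
  with assms(1) show ?thesis
    by (simp add: square_integrable_def)
qed

lemma mult_cnj_self: "z * cnj z = complex_of_real ((cmod z)\<^sup>2)"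
  by (simp only: complex_mult_cnj cmod_power2)

lemma cmod_mult_le_sum_squares: "cmod (a * b) \<le> (cmod a)\<^sup>2 + (cmod b)\<^sup>2"
proof -
  have "2 * (cmod a * cmod b) \<le> (cmod a)\<^sup>2 + (cmod b)\<^sup>2"
    using sum_squares_bound[of "cmod a" "cmod b"] by (simp add: mult.assoc)
  moreover have "0 \<le> cmod a * cmod b"
    by simp
  ultimately show ?thesis
    unfolding norm_mult by linarith
qed

lemma cmod_add_square_le: "(cmod (a + b))\<^sup>2 \<le> 2 * ((cmod a)\<^sup>2 + (cmod b)\<^sup>2)"
proof -
  have "(cmod (a + b))\<^sup>2 \<le> (cmod a + cmod b)\<^sup>2"
    by (intro power_mono norm_triangle_ineq) auto
  also have "\<dots> \<le> 2 * ((cmod a)\<^sup>2 + (cmod b)\<^sup>2)"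
    using sum_squares_bound[of "cmod a" "cmod b"] by (simp add: power2_sum)
  finally show ?thesis .
qed

lemma square_integrable_add:
  assumes f: "f \<in> square_integrable" and g: "g \<in> square_integrable"
  shows "(\<lambda>x. f x + g x) \<in> square_integrable"
proof (rule square_integrableI_bound)
  show "(\<lambda>x. f x + g x) \<in> borel_measurable lebesgue"
    using f g by measurable
  show "integrable lebesgue (\<lambda>x. 2 * ((cmod (f x))\<^sup>2 + (cmod (g x))\<^sup>2))"
    using f g by (intro integrable_mult_right Bochner_Integration.integrable_add square_integrable_integrable)
qed (rule cmod_add_square_le)

lemma square_integrable_mult_bounded:
  assumes f: "f \<in> square_integrable" and g [measurable]: "g \<in> borel_measurable lebesgue"
    and B: "\<And>x. cmod (g x) \<le> B"
  shows "(\<lambda>x. g x * f x) \<in> square_integrable"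
proof (rule square_integrableI_bound)
  show "(\<lambda>x. g x * f x) \<in> borel_measurable lebesgue"
    using f by measurable
  show "integrable lebesgue (\<lambda>x. B\<^sup>2 * (cmod (f x))\<^sup>2)"
    using f by (auto intro: square_integrable_integrable)
  show "(cmod (g x * f x))\<^sup>2 \<le> B\<^sup>2 * (cmod (f x))\<^sup>2" for x
    using B[of x] by (auto simp: norm_mult power_mult_distrib intro!: mult_right_mono power_mono)
qed

lemma square_integrable_cmult:
  "f \<in> square_integrable \<Longrightarrow> (\<lambda>x. a * f x) \<in> square_integrable"
  by (rule square_integrable_mult_bounded[where B = "cmod a"]) auto

lemma square_integrable_diff:
  assumes "f \<in> square_integrable" "g \<in> square_integrable"
  shows "(\<lambda>x. f x - g x) \<in> square_integrable"
  using square_integrable_add[OF assms(1) square_integrable_cmult[OF assms(2), of "-1"]] by simp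

lemma square_integrable_sum:
  "finite F \<Longrightarrow> (\<And>i. i \<in> F \<Longrightarrow> f i \<in> square_integrable) \<Longrightarrow>
    (\<lambda>x. \<Sum>i\<in>F. f i x) \<in> square_integrable"
proof (induction F rule: finite_induct)
  case empty
  show ?case by (simp add: square_integrable_def)
next
  case (insert i F)
  then show ?case by (simp add: square_integrable_add)
qed

lemma square_integrable_indicator_mult:
  assumes "f \<in> square_integrable" and [measurable]: "A \<in> sets lebesgue"
  shows "(\<lambda>x. indicator A x * f x) \<in> square_integrable"
  by (rule square_integrable_mult_bounded[where B = 1])
     (use assms in \<open>auto simp: indicator_def\<close>)

lemma integrable_mult_cnj:
  assumes f: "f \<in> square_integrable" and g: "g \<in> square_integrable"
  shows "integrable lebesgue (\<lambda>x. f x * cnj (g x))"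
proof (rule Bochner_Integration.integrable_bound)
  show "integrable lebesgue (\<lambda>x. (cmod (f x))\<^sup>2 + (cmod (g x))\<^sup>2)"
    using f g by (auto intro: square_integrable_integrable)
  show "(\<lambda>x. f x * cnj (g x)) \<in> borel_measurable lebesgue"
    using f g by measurable
  show "AE x in lebesgue. norm (f x * cnj (g x)) \<le> norm ((cmod (f x))\<^sup>2 + (cmod (g x))\<^sup>2)"
  proof (intro always_eventually allI)
    fix x
    have "norm (f x * cnj (g x)) \<le> (cmod (f x))\<^sup>2 + (cmod (g x))\<^sup>2"
      using cmod_mult_le_sum_squares[of "f x" "cnj (g x)"] by simp
    also have "\<dots> \<le> norm ((cmod (f x))\<^sup>2 + (cmod (g x))\<^sup>2)"
      by simp
    finally show "norm (f x * cnj (g x)) \<le> norm ((cmod (f x))\<^sup>2 + (cmod (g x))\<^sup>2)" .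
  qed
qed

definition l2_sq :: "(real \<Rightarrow> complex) \<Rightarrow> real" where
  "l2_sq f = (LINT x|lebesgue. (cmod (f x))\<^sup>2)"

lemma l2_sq_nonneg: "0 \<le> l2_sq f"
  by (simp add: l2_sq_def)

lemma l2_norm_eq: "l2_norm f = sqrt (l2_sq f)"
  by (simp add: l2_norm_def l2_sq_def)

lemma l2_inner_self: "l2_inner f f = complex_of_real (l2_sq f)"
  unfolding l2_inner_def l2_sq_def by (simp only: mult_cnj_self integral_complex_of_real)

lemma nn_integral_square_integrable:
  "f \<in> square_integrable \<Longrightarrow> (\<integral>\<^sup>+x. ennreal ((cmod (f x))\<^sup>2) \<partial>lebesgue) = ennreal (l2_sq f)"
  unfolding l2_sq_def by (rule nn_integral_eq_integral) (auto intro: square_integrable_integrable)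

lemma square_integrable_if_nn_integral_finite:
  assumes [measurable]: "f \<in> borel_measurable lebesgue"
    and "(\<integral>\<^sup>+x. ennreal ((cmod (f x))\<^sup>2) \<partial>lebesgue) < \<infinity>"
  shows "f \<in> square_integrable"
  unfolding square_integrable_def using assms by (auto intro!: integrableI_nonneg)

lemma l2_inner_commute: "l2_inner g f = cnj (l2_inner f g)"
  unfolding l2_inner_def
  by (subst Bochner_Integration.integral_cnj[symmetric]) (auto intro!: Bochner_Integration.integral_cong simp: mult.commute)

lemma l2_inner_cmult_left: "l2_inner (\<lambda>x. a * f x) g = a * l2_inner f g"
  by (simp add: l2_inner_def mult.assoc)

lemma l2_inner_diff_left:
  assumes "f \<in> square_integrable" "g \<in> square_integrable" "h \<in> square_integrable"
  shows "l2_inner (\<lambda>x. f x - g x) h = l2_inner f h - l2_inner g h"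
  using assms by (simp add: l2_inner_def left_diff_distrib integrable_mult_cnj)

lemma l2_inner_sum_left:
  assumes "finite F" "\<And>i. i \<in> F \<Longrightarrow> f i \<in> square_integrable" "h \<in> square_integrable"
  shows "l2_inner (\<lambda>x. \<Sum>i\<in>F. f i x) h = (\<Sum>i\<in>F. l2_inner (f i) h)"
  using assms unfolding l2_inner_def sum_distrib_right
  by (subst Bochner_Integration.integral_sum) (auto intro: integrable_mult_cnj)

lemma l2_inner_diff_right:
  assumes "f \<in> square_integrable" "g \<in> square_integrable" "h \<in> square_integrable"
  shows "l2_inner h (\<lambda>x. f x - g x) = l2_inner h f - l2_inner h g"
  using l2_inner_diff_left[OF assms] by (metis l2_inner_commute complex_cnj_diff)

lemma l2_sq_diff:
  assumes f: "f \<in> square_integrable" and g: "g \<in> square_integrable"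
  shows "l2_sq (\<lambda>x. f x - g x) = l2_sq f - 2 * Re (l2_inner f g) + l2_sq g"
proof -
  have "complex_of_real (l2_sq (\<lambda>x. f x - g x))
      = l2_inner f f - l2_inner f g - cnj (l2_inner f g) + l2_inner g g"
    using f g by (simp add: l2_inner_self[symmetric] l2_inner_diff_left l2_inner_diff_right
        square_integrable_diff l2_inner_commute[of g f])
  then have "Re (complex_of_real (l2_sq (\<lambda>x. f x - g x)))
      = Re (l2_inner f f - l2_inner f g - cnj (l2_inner f g) + l2_inner g g)"
    by (rule arg_cong)
  then show ?thesis
    by (simp add: l2_inner_self)
qed

lemma l2_sq_cmult: "l2_sq (\<lambda>x. a * f x) = (cmod a)\<^sup>2 * l2_sq f"
  by (simp add: l2_sq_def norm_mult power_mult_distrib)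

text \<open>
  The nonnegative quadratic \<open>t \<mapsto> \<parallel>f - t \<langle>f, g\<rangle> g\<parallel>\<^sup>2\<close> is evaluated at its minimum
  \<open>t = 1 / \<parallel>g\<parallel>\<^sup>2\<close>.  If \<open>\<parallel>g\<parallel> = 0\<close> the quadratic degenerates to a line, which stays nonnegative
  only if its slope vanishes.
\<close>

lemma l2_Cauchy_Schwarz:
  assumes f: "f \<in> square_integrable" and g: "g \<in> square_integrable"
  shows "(cmod (l2_inner f g))\<^sup>2 \<le> l2_sq f * l2_sq g"
proof -
  let ?a = "l2_inner f g"
  have *: "0 \<le> l2_sq f - 2 * t * (cmod ?a)\<^sup>2 + t\<^sup>2 * (cmod ?a)\<^sup>2 * l2_sq g" for t :: real
  proof -
    let ?b = "complex_of_real t * ?a"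
    have "l2_inner f (\<lambda>x. ?b * g x) = cnj ?b * ?a"
      by (subst l2_inner_commute) (simp add: l2_inner_cmult_left l2_inner_commute[of g f])
    also have "\<dots> = complex_of_real (t * (cmod ?a)\<^sup>2)"
      by (simp add: mult_cnj_self[of ?a, symmetric] mult_ac del: of_real_power)
    finally have "Re (l2_inner f (\<lambda>x. ?b * g x)) = t * (cmod ?a)\<^sup>2"
      by simp
    moreover have "0 \<le> l2_sq (\<lambda>x. f x - ?b * g x)"
      by (rule l2_sq_nonneg)
    moreover have "l2_sq (\<lambda>x. ?b * g x) = t\<^sup>2 * (cmod ?a)\<^sup>2 * l2_sq g"
      by (simp add: l2_sq_cmult norm_mult power_mult_distrib)
    ultimately show ?thesis
      unfolding l2_sq_diff[OF f square_integrable_cmult[OF g]] by linarith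
  qed
  show ?thesis
  proof (cases "l2_sq g = 0")
    case True
    have "(cmod ?a)\<^sup>2 = 0"
    proof (rule ccontr)
      assume "(cmod ?a)\<^sup>2 \<noteq> 0"
      then have "l2_sq f - 2 * ((l2_sq f + 1) / (2 * (cmod ?a)\<^sup>2)) * (cmod ?a)\<^sup>2 = -1"
        by (simp add: field_simps)
      with *[of "(l2_sq f + 1) / (2 * (cmod ?a)\<^sup>2)"] True show False
        by simp
    qed
    with True show ?thesis by simp
  next
    case False
    with l2_sq_nonneg[of g] have "l2_sq g > 0" by linarith
    with *[of "1 / l2_sq g"] show ?thesis
      by (simp add: field_simps power2_eq_square)
  qed
qed

definition orthonormal :: "('i \<Rightarrow> real \<Rightarrow> complex) \<Rightarrow> bool" where
  "orthonormal e \<longleftrightarrow> (\<forall>i. e i \<in> square_integrable) \<and>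
     (\<forall>i j. l2_inner (e i) (e j) = (if i = j then 1 else 0))"

text \<open>
  Completing the square in the coefficients.  It yields Bessel's inequality and the fact that the
  Fourier coefficients give the best approximation, which turn density of finite sums into
  Parseval's identity and back.
\<close>

lemma l2_sq_diff_orthonormal_sum:
  assumes e: "orthonormal e" and f: "f \<in> square_integrable" and F: "finite F"
  shows "l2_sq (\<lambda>x. f x - (\<Sum>i\<in>F. a i * e i x))
       = l2_sq f - (\<Sum>i\<in>F. (cmod (l2_inner f (e i)))\<^sup>2) + (\<Sum>i\<in>F. (cmod (a i - l2_inner f (e i)))\<^sup>2)"
proof -
  let ?s = "\<lambda>x. \<Sum>i\<in>F. a i * e i x" and ?c = "\<lambda>i. l2_inner f (e i)"
  have ei: "e i \<in> square_integrable" for i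
    using e by (simp add: orthonormal_def)
  have s: "?s \<in> square_integrable"
    by (intro square_integrable_sum square_integrable_cmult F ei)
  have sum_inner: "l2_inner ?s h = (\<Sum>i\<in>F. a i * l2_inner (e i) h)" if "h \<in> square_integrable" for h
    using that by (simp add: l2_inner_sum_left F square_integrable_cmult ei l2_inner_cmult_left)
  have "l2_inner ?s (e j) = a j" if "j \<in> F" for j
  proof -
    have "l2_inner ?s (e j) = (\<Sum>i\<in>F. if i = j then a i else 0)"
      unfolding sum_inner[OF ei] using e by (intro sum.cong) (auto simp: orthonormal_def)
    then show ?thesis
      using that F by simp
  qed
  then have "l2_inner (e j) ?s = cnj (a j)" if "j \<in> F" for j
    using that by (simp add: l2_inner_commute[of "e j"])
  then have "l2_inner ?s ?s = (\<Sum>i\<in>F. a i * cnj (a i))"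
    unfolding sum_inner[OF s] by simp
  then have "complex_of_real (l2_sq ?s) = complex_of_real (\<Sum>i\<in>F. (cmod (a i))\<^sup>2)"
    by (simp add: l2_inner_self mult_cnj_self)
  then have ss: "l2_sq ?s = (\<Sum>i\<in>F. (cmod (a i))\<^sup>2)"
    by (simp only: of_real_eq_iff)
  have "l2_inner f ?s = (\<Sum>i\<in>F. cnj (a i) * ?c i)"
    by (subst l2_inner_commute) (simp add: sum_inner[OF f] l2_inner_commute[of "e _" f])
  then have fs: "Re (l2_inner f ?s) = (\<Sum>i\<in>F. Re (cnj (a i) * ?c i))"
    by (simp only: Re_sum)
  have "(cmod (a i - ?c i))\<^sup>2 = (cmod (a i))\<^sup>2 - 2 * Re (cnj (a i) * ?c i) + (cmod (?c i))\<^sup>2" for i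
    unfolding cmod_power2 by (simp add: power2_eq_square algebra_simps)
  then have "(\<Sum>i\<in>F. (cmod (a i - ?c i))\<^sup>2)
      = l2_sq ?s - 2 * Re (l2_inner f ?s) + (\<Sum>i\<in>F. (cmod (?c i))\<^sup>2)"
    unfolding ss fs by (simp add: sum.distrib sum_subtractf sum_distrib_left)
  then show ?thesis
    unfolding l2_sq_diff[OF f s] by linarith
qed

section \<open>Trigonometric polynomials are dense on the unit interval\<close>

text \<open>
  Trigonometric polynomials of period one.  The inductive form makes the closure under products,
  and hence the substitution of \<open>cis\<close> into polynomials, a matter of rule induction.
\<close>

inductive trig_poly :: "(real \<Rightarrow> complex) \<Rightarrow> bool" where
  monomial: "trig_poly (\<lambda>x. a * cis (2 * pi * real_of_int k * x))"
| add: "trig_poly f \<Longrightarrow> trig_poly g \<Longrightarrow> trig_poly (\<lambda>x. f x + g x)"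

lemma trig_poly_const: "trig_poly (\<lambda>x. a)"
  using trig_poly.monomial[of a 0] by simp

lemma trig_poly_mult:
  assumes "trig_poly f" "trig_poly g"
  shows "trig_poly (\<lambda>x. f x * g x)"
  using assms
proof (induction arbitrary: g)
  case (monomial a k)
  from monomial.prems show ?case
  proof induction
    case (monomial b l)
    have "(\<lambda>x. a * cis (2 * pi * real_of_int k * x) * (b * cis (2 * pi * real_of_int l * x)))
        = (\<lambda>x. (a * b) * cis (2 * pi * real_of_int (k + l) * x))"
      by (auto simp: fun_eq_iff algebra_simps cis_mult[symmetric])
    then show ?case
      by (simp only: trig_poly.monomial)
  next
    case (add f g)
    then show ?case
      by (simp add: distrib_left trig_poly.add)
  qed
next
  case (add f f')
  then show ?case
    by (simp add: distrib_right trig_poly.add)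
qed

text \<open>
  A real-linear form on the complex plane is a combination of \<open>z\<close> and its conjugate, and the
  conjugate of \<open>cis t\<close> is \<open>cis (- t)\<close>; sums and products stay trigonometric.
\<close>

lemma trig_poly_real_polynomial_cis:
  assumes "real_polynomial_function p"
  shows "trig_poly (\<lambda>x. complex_of_real (p (cis (2 * pi * x))))"
  using assms
proof induction
  case (linear p)
  interpret bounded_linear p by fact
  let ?u = "complex_of_real (p 1)" and ?v = "complex_of_real (p \<i>)"
  have p: "p z = Re z * p 1 + Im z * p \<i>" for z
  proof -
    have "z = Re z *\<^sub>R 1 + Im z *\<^sub>R \<i>"
      by (simp add: complex_eq_iff)
    then have "p z = p (Re z *\<^sub>R 1 + Im z *\<^sub>R \<i>)"
      by simp
    also have "\<dots> = Re z * p 1 + Im z * p \<i>"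
      by (simp add: add scaleR del: real_scaleR_def) (simp add: scaleR_conv_of_real)
    finally show ?thesis .
  qed
  have "complex_of_real (p (cis (2 * pi * x)))
      = (?u - \<i> * ?v) / 2 * cis (2 * pi * real_of_int 1 * x)
      + (?u + \<i> * ?v) / 2 * cis (2 * pi * real_of_int (-1) * x)" for x
    by (subst p) (simp add: complex_eq_iff field_simps)
  then show ?case
    by (simp only: trig_poly.intros)
next
  case (const c)
  show ?case by (rule trig_poly_const)
next
  case (add f g)
  then show ?case by (simp add: trig_poly.add)
next
  case (mult f g)
  then show ?case by (simp add: trig_poly_mult)
qed

lemma trig_poly_polynomial_cis:
  fixes p :: "complex \<Rightarrow> complex"
  assumes "polynomial_function p"
  shows "trig_poly (\<lambda>x. p (cis (2 * pi * x)))"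
proof -
  have "real_polynomial_function (\<lambda>z. Re (p z))" "real_polynomial_function (\<lambda>z. Im (p z))"
    using assms bounded_linear_Re bounded_linear_Im by (auto simp: polynomial_function_def o_def)
  note * = this[THEN trig_poly_real_polynomial_cis]
  have "trig_poly (\<lambda>x. complex_of_real (Re (p (cis (2 * pi * x))))
      + \<i> * complex_of_real (Im (p (cis (2 * pi * x)))))"
    by (intro trig_poly.add trig_poly_mult trig_poly_const *)
  then show ?thesis
    by (simp add: complex_eq[symmetric])
qed

text \<open>
  Since \<open>f 0 = f 1\<close>, the function descends to the unit circle along \<open>x \<mapsto> cis (2 \<pi> x)\<close>.  This map
  is a continuous surjection from a compact space, hence a quotient map, so the descended function
  is continuous and the Stone--Weierstrass theorem applies to it.
\<close>

lemma continuous_periodic_trig_poly_approx: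
  fixes f :: "real \<Rightarrow> complex"
  assumes f: "continuous_on {0..1} f" and per: "f 0 = f 1" and "\<epsilon> > 0"
  obtains T where "trig_poly T" "\<And>x. x \<in> {0..1} \<Longrightarrow> cmod (f x - T x) < \<epsilon>"
proof -
  let ?p = "\<lambda>x. cis (2 * pi * x)"
  define F where "F z = f (Arg2pi z / (2 * pi))" for z
  have Fp: "F (?p x) = f x" if "x \<in> {0..1}" for x
  proof (cases "x = 1")
    case True
    then show ?thesis by (simp add: F_def per Arg2pi_of_real[of 1, simplified])
  next
    case False
    with that have "2 * pi * x < 2 * pi * 1" by (intro mult_strict_left_mono) auto
    then have "Arg2pi (?p x) = 2 * pi * x"
      using that by (intro Arg2pi_unique[of 1]) (auto simp: cis_conv_exp)
    then show ?thesis by (simp add: F_def)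
  qed
  have p: "continuous_on {0..1} ?p"
    by (auto simp: cis_conv_exp intro!: continuous_intros)
  have img: "?p ` {0..1} = sphere 0 1"
  proof (intro equalityI subsetI)
    fix z :: complex assume "z \<in> sphere 0 1"
    then have "z = ?p (Arg2pi z / (2 * pi))"
      using Arg2pi[of z] by (simp add: cis_conv_exp is_Arg_def)
    moreover have "Arg2pi z / (2 * pi) \<in> {0..1}"
      using Arg2pi[of z] by (auto simp: field_simps)
    ultimately show "z \<in> ?p ` {0..1}" by blast
  qed auto
  have F: "continuous_on (sphere 0 1) F"
    unfolding continuous_openin_preimage_eq
  proof (intro allI impI)
    fix V :: "complex set" assume "open V"
    then have "openin (top_of_set {0..1}) ({0..1} \<inter> f -` V)"
      using f by (simp add: continuous_openin_preimage_eq)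
    also have "{0..1} \<inter> f -` V = {0..1} \<inter> ?p -` (sphere 0 1 \<inter> F -` V)"
      using Fp img by auto
    finally show "openin (top_of_set (sphere 0 1)) (sphere 0 1 \<inter> F -` V)"
      by (subst (asm) Abstract_Topology_2.continuous_imp_quotient_map[OF p img]) auto
  qed
  obtain g where g: "polynomial_function g" "\<And>z. z \<in> sphere 0 1 \<Longrightarrow> cmod (F z - g z) < \<epsilon>"
    using Stone_Weierstrass_polynomial_function[OF compact_sphere F \<open>\<epsilon> > 0\<close>] by blast
  show ?thesis
  proof
    show "trig_poly (\<lambda>x. g (?p x))"
      by (rule trig_poly_polynomial_cis[OF g(1)])
    show "cmod (f x - g (?p x)) < \<epsilon>" if "x \<in> {0..1}" for x
      using g(2)[of "?p x"] Fp[OF that] by simp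
  qed
qed

lemma l2_sq_dominated_tendsto_0:
  fixes u :: "nat \<Rightarrow> real \<Rightarrow> complex"
  assumes "\<And>n. u n \<in> borel_measurable lebesgue" "integrable lebesgue w"
    and "\<And>n x. (cmod (u n x))\<^sup>2 \<le> w x" "AE x in lebesgue. (\<lambda>n. u n x) \<longlonglongrightarrow> 0"
  shows "(\<lambda>n. l2_sq (u n)) \<longlonglongrightarrow> 0"
proof -
  have "(\<lambda>n. LINT x|lebesgue. (cmod (u n x))\<^sup>2) \<longlonglongrightarrow> (LINT x::real|lebesgue. 0)"
  proof (rule Bochner_Integration.integral_dominated_convergence[where w = w])
    show "(\<lambda>x. (cmod (u n x))\<^sup>2) \<in> borel_measurable lebesgue" for n
      using assms(1)[of n] by measurable
    show "AE x in lebesgue. (\<lambda>n. (cmod (u n x))\<^sup>2) \<longlonglongrightarrow> 0"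
      using assms(4)
    proof eventually_elim
      case (elim x)
      then show ?case
        using tendsto_power[OF tendsto_norm[OF elim], of 2] by simp
    qed
  qed (use assms in auto)
  then show ?thesis
    by (simp add: l2_sq_def)
qed

text \<open>
  Membership in the closure, for the norm of \<open>L\<^sup>2[0, 1]\<close>, of the trigonometric polynomials.  Square
  integrability over the whole line is included so that the calculus of \<open>square_integrable\<close> applies.
\<close>

definition trig_approximable :: "(real \<Rightarrow> complex) \<Rightarrow> bool" where
  "trig_approximable h \<longleftrightarrow> h \<in> square_integrable \<and>
     (\<forall>\<epsilon>>0. \<exists>T. trig_poly T \<and> l2_sq (\<lambda>x. indicator {0..1} x * (h x - T x)) < \<epsilon>)"

lemma trig_poly_continuous: "trig_poly T \<Longrightarrow> continuous_on A T"
  by (induction rule: trig_poly.induct) (auto simp: cis_conv_exp intro!: continuous_intros)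

lemma square_integrable_indicator_continuous:
  assumes f: "continuous_on {a..b} f"
  shows "(\<lambda>x. indicator {a..b::real} x * f x) \<in> square_integrable"
proof -
  have "integrable lborel (\<lambda>x. indicator {a..b} x *\<^sub>R (cmod (f x))\<^sup>2)"
    by (rule borel_integrable_compact) (auto intro!: continuous_intros f)
  then have "integrable lebesgue (\<lambda>x. indicator {a..b} x *\<^sub>R (cmod (f x))\<^sup>2)"
    by (simp add: integrable_completion borel_measurable_integrable)
  then have 1: "integrable lebesgue (\<lambda>x. (cmod (indicator {a..b} x * f x))\<^sup>2)"
    by (rule Bochner_Integration.integrable_cong[THEN iffD1, rotated -1]) (auto simp: indicator_def)
  have "integrable lborel (\<lambda>x. indicator {a..b} x *\<^sub>R f x)"
    by (rule borel_integrable_compact[OF compact_Icc f])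
  then have "(\<lambda>x. indicator {a..b} x *\<^sub>R f x) \<in> borel_measurable lebesgue"
    by (intro measurable_completion borel_measurable_integrable)
  then have 2: "(\<lambda>x. indicator {a..b} x * f x) \<in> borel_measurable lebesgue"
    by (rule measurable_cong[THEN iffD1, rotated -1]) (auto simp: indicator_def)
  show ?thesis
    using 1 2 by (simp add: square_integrable_def)
qed

lemma trig_approximable_limit:
  assumes h: "h \<in> square_integrable" and u: "\<And>n. trig_approximable (u n)"
    and lim: "(\<lambda>n. l2_sq (\<lambda>x. indicator {0..1} x * (h x - u n x))) \<longlonglongrightarrow> 0"
  shows "trig_approximable h"
  unfolding trig_approximable_def
proof (intro conjI allI impI h)
  fix \<epsilon> :: real assume "\<epsilon> > 0"
  let ?I = "indicator {0..1} :: real \<Rightarrow> complex"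
  have "eventually (\<lambda>n. l2_sq (\<lambda>x. ?I x * (h x - u n x)) < \<epsilon> / 4) sequentially"
    using order_tendstoD(2)[OF lim, of "\<epsilon> / 4"] \<open>\<epsilon> > 0\<close> by simp
  then obtain n where n: "l2_sq (\<lambda>x. ?I x * (h x - u n x)) < \<epsilon> / 4"
    by (auto simp: eventually_sequentially)
  obtain T where T: "trig_poly T" "l2_sq (\<lambda>x. ?I x * (u n x - T x)) < \<epsilon> / 4"
    using u[of n] \<open>\<epsilon> > 0\<close> unfolding trig_approximable_def by (meson divide_pos_pos zero_less_numeral)
  have un: "u n \<in> square_integrable"
    using u[of n] by (simp add: trig_approximable_def)
  have sq1: "(\<lambda>x. ?I x * (h x - u n x)) \<in> square_integrable"
    using h un by (intro square_integrable_indicator_mult square_integrable_diff) auto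
  have "(\<lambda>x. ?I x * u n x - ?I x * T x) \<in> square_integrable"
    using un T(1) by (intro square_integrable_diff square_integrable_indicator_mult
        square_integrable_indicator_continuous trig_poly_continuous) auto
  then have sq2: "(\<lambda>x. ?I x * (u n x - T x)) \<in> square_integrable"
    by (simp add: right_diff_distrib)
  have "l2_sq (\<lambda>x. ?I x * (h x - T x))
      \<le> (LINT x|lebesgue. 2 * ((cmod (?I x * (h x - u n x)))\<^sup>2 + (cmod (?I x * (u n x - T x)))\<^sup>2))"
    unfolding l2_sq_def
  proof (rule Bochner_Integration.integral_mono)
    have eq: "?I x * (h x - T x) = ?I x * (h x - u n x) + ?I x * (u n x - T x)" for x
      by (simp add: algebra_simps)
    show "integrable lebesgue (\<lambda>x. (cmod (?I x * (h x - T x)))\<^sup>2)"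
      unfolding eq by (intro square_integrable_integrable square_integrable_add sq1 sq2)
    show "(cmod (?I x * (h x - T x)))\<^sup>2
        \<le> 2 * ((cmod (?I x * (h x - u n x)))\<^sup>2 + (cmod (?I x * (u n x - T x)))\<^sup>2)" for x
      unfolding eq by (rule cmod_add_square_le)
  qed (intro integrable_mult_right Bochner_Integration.integrable_add square_integrable_integrable sq1 sq2)
  also have "\<dots> = 2 * (l2_sq (\<lambda>x. ?I x * (h x - u n x)) + l2_sq (\<lambda>x. ?I x * (u n x - T x)))"
    unfolding l2_sq_def using square_integrable_integrable[OF sq1] square_integrable_integrable[OF sq2]
    by (subst integral_mult_right_zero, subst Bochner_Integration.integral_add) auto
  also have "\<dots> < \<epsilon>"
    using n T(2) by simp
  finally show "\<exists>T. trig_poly T \<and> l2_sq (\<lambda>x. ?I x * (h x - T x)) < \<epsilon>"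
    using T(1) by blast
qed

lemma trig_approximable_continuous:
  assumes f: "continuous_on {0..1} f" and per: "f 0 = f 1"
  shows "trig_approximable (\<lambda>x. indicator {0..1} x * f x)"
  unfolding trig_approximable_def
proof (intro conjI allI impI square_integrable_indicator_continuous f)
  fix \<epsilon> :: real assume "\<epsilon> > 0"
  let ?I = "indicator {0..1} :: real \<Rightarrow> complex"
  obtain T where T: "trig_poly T" "\<And>x. x \<in> {0..1} \<Longrightarrow> cmod (f x - T x) < sqrt (\<epsilon> / 2)"
    using continuous_periodic_trig_poly_approx[OF f per, of "sqrt (\<epsilon> / 2)"] \<open>\<epsilon> > 0\<close> by auto
  have "l2_sq (\<lambda>x. ?I x * (?I x * f x - T x)) \<le> (LINT x|lebesgue. indicator {0..1::real} x * (\<epsilon> / 2))"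
    unfolding l2_sq_def
  proof (rule Bochner_Integration.integral_mono)
    have "(\<lambda>x. ?I x * (f x - T x)) \<in> square_integrable"
      by (intro square_integrable_indicator_continuous continuous_intros f trig_poly_continuous T)
    also have "(\<lambda>x. ?I x * (f x - T x)) = (\<lambda>x. ?I x * (?I x * f x - T x))"
      by (auto simp: fun_eq_iff indicator_def)
    finally show "integrable lebesgue (\<lambda>x. (cmod (?I x * (?I x * f x - T x)))\<^sup>2)"
      by (rule square_integrable_integrable)
    show "integrable lebesgue (\<lambda>x. indicator {0..1::real} x * (\<epsilon> / 2))"
      by (intro integrable_mult_left integrable_real_indicator) auto
    show "(cmod (?I x * (?I x * f x - T x)))\<^sup>2 \<le> indicator {0..1} x * (\<epsilon> / 2)" for x
    proof (cases "x \<in> {0..1}")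
      case True
      have "(cmod (f x - T x))\<^sup>2 \<le> (sqrt (\<epsilon> / 2))\<^sup>2"
        using T(2)[OF True] by (intro power_mono) auto
      with True \<open>\<epsilon> > 0\<close> show ?thesis by simp
    qed auto
  qed
  also have "\<dots> = \<epsilon> / 2"
    by simp
  also have "\<dots> < \<epsilon>"
    using \<open>\<epsilon> > 0\<close> by simp
  finally show "\<exists>T. trig_poly T \<and> l2_sq (\<lambda>x. ?I x * (?I x * f x - T x)) < \<epsilon>"
    using T(1) by blast
qed


text \<open>
  A Lebesgue measurable function is an almost-everywhere limit of continuous functions \<open>g n\<close>.
  Clipping their values at the bound of \<open>h\<close> makes dominated convergence applicable, and a cut-off
  that vanishes at \<open>0\<close> and \<open>1\<close> and tends to \<open>1\<close> in between makes them periodic.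
\<close>

lemma trig_approximable_bounded:
  assumes h: "h \<in> square_integrable" and B: "\<And>x. cmod (h x) \<le> B"
  shows "trig_approximable h"
proof -
  let ?I = "indicator {0..1} :: real \<Rightarrow> complex"
  define b where "b = max B 1"
  have b: "b > 0" "cmod (h x) \<le> b" for x
    using B[of x] by (auto simp: b_def)
  have "h measurable_on UNIV"
    using h by (intro lebesgue_measurable_imp_measurable_on) (auto simp: square_integrable_def)
  then obtain N g where N: "negligible N" and g: "\<And>n. continuous_on UNIV (g n)"
    and lim: "\<And>x. x \<notin> N \<Longrightarrow> (\<lambda>n::nat. g n x) \<longlonglongrightarrow> h x"
    unfolding measurable_on_def by auto
  define cut where "cut n x = complex_of_real (min 1 (real n * (x * (1 - x))))" for n x
  define clip where "clip z = z / complex_of_real (max 1 (cmod z / b))" for z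
  define u where "u n x = cut n x * clip (g n x)" for n x
  have max_pos: "max 1 t \<noteq> 0" for t :: real by linarith
  have clip_cont: "continuous_on UNIV clip"
    unfolding clip_def using b(1) max_pos by (intro continuous_intros) auto
  have clip_le: "cmod (clip z) \<le> b" for z
  proof -
    have "cmod z \<le> max 1 (cmod z / b) * b"
      using b(1) by (auto simp: max_def field_simps)
    then show ?thesis
      unfolding clip_def by (simp add: norm_divide divide_le_eq mult.commute)
  qed
  have clip_id: "clip (h x) = h x" for x
  proof -
    have "max 1 (cmod (h x) / b) = 1"
      using b(1) b(2)[of x] by (intro max_absorb1) (simp add: divide_le_eq)
    then show ?thesis by (simp add: clip_def)
  qed
  have cut_le: "cmod (cut n x) \<le> 1" if "x \<in> {0..1}" for n x
    using that by (auto simp: cut_def)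
  have u_cont: "continuous_on A (u n)" for A n
    unfolding u_def cut_def
    by (intro continuous_intros continuous_on_subset[OF g]
        continuous_on_compose2[OF clip_cont]) auto
  have u_le: "cmod (u n x) \<le> b" if "x \<in> {0..1}" for n x
    using mult_mono[OF cut_le[OF that] clip_le] by (simp add: u_def norm_mult)
  have u_lim: "(\<lambda>n. u n x) \<longlonglongrightarrow> h x" if "x \<notin> N" "0 < x" "x < 1" for x
  proof -
    have "(\<lambda>n. clip (g n x)) \<longlonglongrightarrow> clip (h x)"
      using clip_cont lim[OF that(1)] by (rule continuous_on_tendsto_compose) auto
    \<comment> \<open>At an interior point the cut-off is eventually \<open>1\<close>, since \<open>x (1 - x)\<close> is positive there.\<close>
    moreover have "eventually (\<lambda>n. cut n x = 1) sequentially"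
    proof -
      have pos: "0 < x * (1 - x)"
        using that by simp
      obtain m :: nat where "1 / (x * (1 - x)) < real m"
        using reals_Archimedean2 by blast
      then have "1 < real m * (x * (1 - x))"
        using pos by (simp add: divide_less_eq)
      then have "1 \<le> real n * (x * (1 - x))" if "n \<ge> m" for n
        using that pos mult_right_mono[of "real m" "real n" "x * (1 - x)"] by simp
      then show ?thesis
        by (auto simp: eventually_sequentially cut_def intro!: exI[of _ m])
    qed
    then have "(\<lambda>n. cut n x) \<longlonglongrightarrow> 1"
      by (rule tendsto_eventually)
    ultimately have "(\<lambda>n. cut n x * clip (g n x)) \<longlonglongrightarrow> 1 * clip (h x)"
      by (intro tendsto_intros)
    then show ?thesis
      by (simp add: u_def clip_id)
  qed
  show ?thesis
  proof (rule trig_approximable_limit[OF h])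
    show "trig_approximable (\<lambda>x. ?I x * u n x)" for n
      by (rule trig_approximable_continuous[OF u_cont]) (simp add: u_def cut_def)
    show "(\<lambda>n. l2_sq (\<lambda>x. ?I x * (h x - ?I x * u n x))) \<longlonglongrightarrow> 0"
    proof (rule l2_sq_dominated_tendsto_0)
      show "(\<lambda>x. ?I x * (h x - ?I x * u n x)) \<in> borel_measurable lebesgue" for n
        using h by (intro square_integrable_measurable square_integrable_indicator_mult
            square_integrable_diff square_integrable_indicator_continuous u_cont) auto
      show "integrable lebesgue (\<lambda>x. indicator {0..1::real} x * (2 * b)\<^sup>2)"
        by (intro integrable_mult_left integrable_real_indicator) auto
      show "(cmod (?I x * (h x - ?I x * u n x)))\<^sup>2 \<le> indicator {0..1} x * (2 * b)\<^sup>2" for n x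
      proof (cases "x \<in> {0..1}")
        case True
        have "cmod (h x - u n x) \<le> 2 * b"
          using norm_triangle_ineq4[of "h x" "u n x"] b(2)[of x] u_le[OF True, of n] by linarith
        then have "(cmod (h x - u n x))\<^sup>2 \<le> (2 * b)\<^sup>2"
          by (intro power_mono) auto
        with True show ?thesis by simp
      qed auto
      have "AE x in lebesgue. x \<notin> N \<union> {0, 1}"
        using N by (intro AE_not_in) (auto simp: negligible_iff_null_sets)
      then show "AE x in lebesgue. (\<lambda>n. ?I x * (h x - ?I x * u n x)) \<longlonglongrightarrow> 0"
      proof eventually_elim
        case (elim x)
        show ?case
        proof (cases "x \<in> {0..1}")
          case True
          then have "(\<lambda>n. h x - u n x) \<longlonglongrightarrow> h x - h x"
            using elim by (intro tendsto_intros u_lim) auto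
          with True show ?thesis by simp
        qed auto
      qed
    qed
  qed
qed

text \<open>
  The general case follows from the bounded one by cutting \<open>h\<close> off where its modulus exceeds \<open>n\<close>.
\<close>

lemma trig_approximable_square_integrable:
  assumes h: "h \<in> square_integrable"
  shows "trig_approximable h"
proof (rule trig_approximable_limit[OF h])
  let ?I = "indicator {0..1} :: real \<Rightarrow> complex"
  define u where "u n x = (if cmod (h x) \<le> real n then 1 else 0) * h x" for n x
  have u: "u n \<in> square_integrable" for n
    unfolding u_def using h
    by (intro square_integrable_mult_bounded[where B = 1] h) auto
  then show "trig_approximable (u n)" for n
    by (rule trig_approximable_bounded[where B = "real n"]) (auto simp: u_def)
  show "(\<lambda>n. l2_sq (\<lambda>x. ?I x * (h x - u n x))) \<longlonglongrightarrow> 0"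
  proof (rule l2_sq_dominated_tendsto_0)
    show "(\<lambda>x. ?I x * (h x - u n x)) \<in> borel_measurable lebesgue" for n
      using h u by (intro square_integrable_measurable square_integrable_indicator_mult
          square_integrable_diff) auto
    show "integrable lebesgue (\<lambda>x. (cmod (h x))\<^sup>2)"
      by (rule square_integrable_integrable[OF h])
    show "(cmod (?I x * (h x - u n x)))\<^sup>2 \<le> (cmod (h x))\<^sup>2" for n x
      by (auto simp: u_def indicator_def)
    have "(\<lambda>n. ?I x * (h x - u n x)) \<longlonglongrightarrow> 0" for x
    proof -
      obtain m :: nat where "cmod (h x) < real m"
        using reals_Archimedean2 by blast
      then have "eventually (\<lambda>n. ?I x * (h x - u n x) = 0) sequentially"
        by (auto simp: eventually_sequentially u_def intro!: exI[of _ m])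
      then show ?thesis
        by (rule tendsto_eventually)
    qed
    then show "AE x in lebesgue. (\<lambda>n. ?I x * (h x - u n x)) \<longlonglongrightarrow> 0"
      by simp
  qed
qed

section \<open>Parseval's identity on the unit interval\<close>

text \<open>
  Parseval sums are needed in two guises: as \<open>has_sum\<close>, to extract finite partial sums, and as
  integrals over a counting measure, to be exchanged with Lebesgue integrals by Tonelli's theorem.
\<close>

lemma nn_integral_count_space_eq_iff_has_sum:
  fixes c :: "'i \<Rightarrow> real"
  assumes nonneg: "\<And>i. 0 \<le> c i" and S: "0 \<le> S"
  shows "(\<integral>\<^sup>+i. ennreal (c i) \<partial>count_space UNIV) = ennreal S \<longleftrightarrow> (c has_sum S) UNIV"
proof
  assume eq: "(\<integral>\<^sup>+i. ennreal (c i) \<partial>count_space UNIV) = ennreal S"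
  then have "Infinite_Set_Sum.abs_summable_on c UNIV"
    unfolding Infinite_Set_Sum.abs_summable_on_def using nonneg
    by (intro integrableI_nonneg) auto
  then have sum: "infsetsum c UNIV = infsum c UNIV" and "(\<lambda>i. norm (c i)) summable_on UNIV"
    by (simp_all add: abs_summable_equivalent[symmetric] infsetsum_infsum)
  then have "(c has_sum infsum c UNIV) UNIV"
    using nonneg by (intro has_sum_infsum) simp
  moreover have "infsum c UNIV = S"
    using infsetsum_conv_nn_integral[of UNIV c] nonneg S by (simp add: eq sum)
  ultimately show "(c has_sum S) UNIV" by simp
next
  assume c: "(c has_sum S) UNIV"
  then have "(\<lambda>i. norm (c i)) summable_on UNIV"
    using nonneg by (auto simp: summable_on_def)
  then have "Infinite_Set_Sum.abs_summable_on c UNIV"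
    by (simp add: abs_summable_equivalent[symmetric])
  then show "(\<integral>\<^sup>+i. ennreal (c i) \<partial>count_space UNIV) = ennreal S"
    using nonneg infsumI[OF c] by (simp add: nn_integral_conv_infsetsum infsetsum_infsum)
qed

text \<open>
  The partial sums of the squared coefficients never exceed \<open>\<parallel>f\<parallel>\<^sup>2\<close>, and by the best approximation
  property an approximation of \<open>f\<close> within \<open>\<epsilon>\<close> forces them to come within \<open>\<epsilon>\<close> of it.
\<close>

lemma orthonormal_Parseval:
  assumes e: "orthonormal e" and f: "f \<in> square_integrable"
    and approx: "\<And>\<epsilon>. \<epsilon> > 0 \<Longrightarrow> \<exists>F a. finite F \<and> l2_sq (\<lambda>x. f x - (\<Sum>i\<in>F. a i * e i x)) < \<epsilon>"
  shows "((\<lambda>i. (cmod (l2_inner f (e i)))\<^sup>2) has_sum l2_sq f) UNIV"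
  unfolding has_sum_def
proof (rule tendstoI)
  fix \<epsilon> :: real assume "\<epsilon> > 0"
  let ?c = "\<lambda>i. (cmod (l2_inner f (e i)))\<^sup>2"
  obtain F a where F: "finite F" "l2_sq (\<lambda>x. f x - (\<Sum>i\<in>F. a i * e i x)) < \<epsilon>"
    using approx[OF \<open>\<epsilon> > 0\<close>] by blast
  have "l2_sq f - (\<Sum>i\<in>F. ?c i) < \<epsilon>"
    using F(2) sum_nonneg[of F "\<lambda>i. (cmod (a i - l2_inner f (e i)))\<^sup>2"]
    unfolding l2_sq_diff_orthonormal_sum[OF e f F(1)] by simp
  moreover have "(\<Sum>i\<in>G. ?c i) \<le> l2_sq f" if "finite G" for G
    using l2_sq_nonneg[of "\<lambda>x. f x - (\<Sum>i\<in>G. l2_inner f (e i) * e i x)"]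
    unfolding l2_sq_diff_orthonormal_sum[OF e f that] by simp
  moreover have "(\<Sum>i\<in>F. ?c i) \<le> (\<Sum>i\<in>G. ?c i)" if "finite G" "F \<subseteq> G" for G
    using that by (intro sum_mono2) auto
  ultimately have "dist (\<Sum>i\<in>G. ?c i) (l2_sq f) < \<epsilon>" if "finite G" "F \<subseteq> G" for G
    using that by (fastforce simp: dist_real_def abs_less_iff)
  then show "\<forall>\<^sub>F G in finite_subsets_at_top UNIV. dist (\<Sum>i\<in>G. ?c i) (l2_sq f) < \<epsilon>"
    unfolding eventually_finite_subsets_at_top using F(1) by blast
qed

definition unit_wave :: "int \<Rightarrow> real \<Rightarrow> complex" where
  "unit_wave k x = indicator {0..1} x * cis (2 * pi * real_of_int k * x)"

lemma integral_unit_wave: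
  "(LINT x|lebesgue. unit_wave k x) = (if k = 0 then 1 else 0)"
proof (cases "k = 0")
  case True
  have "(LINT x|lebesgue. unit_wave k x) = (LINT x::real|lebesgue. indicator {0..1} x *\<^sub>R (1::complex))"
    by (intro Bochner_Integration.integral_cong) (auto simp: unit_wave_def True indicator_def)
  also have "\<dots> = 1"
    by (subst Bochner_Integration.integral_scaleR_left) auto
  finally show ?thesis
    using True by simp
next
  case False
  let ?b = "\<i> * complex_of_real (2 * pi * real_of_int k)"
  define G where "G x = exp (?b * complex_of_real x) / ?b" for x :: real
  have b: "?b \<noteq> 0"
    using False by simp
  have 1: "cis (2 * pi * real_of_int k * x) = exp (?b * complex_of_real x)" for x
    by (simp add: cis_conv_exp mult_ac)
  have "(LINT x|lborel. indicator {0..1} x *\<^sub>R cis (2 * pi * real_of_int k * x)) = G 1 - G 0"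
  proof (rule integral_FTC_Icc)
    show "(G has_vector_derivative cis (2 * pi * real_of_int k * x)) (at x within {0..1})" for x
    proof -
      have "((\<lambda>z. exp (?b * z) / ?b) has_field_derivative exp (?b * complex_of_real x))
          (at (complex_of_real x))"
        using b by (auto intro!: derivative_eq_intros)
      from has_vector_derivative_real_field[OF this] show ?thesis
        unfolding G_def 1 .
    qed
    show "continuous_on {0..1} (\<lambda>x. cis (2 * pi * real_of_int k * x))"
      unfolding 1 by (intro continuous_intros)
  qed simp
  also have "G 1 - G 0 = 0"
  proof -
    have "exp (?b * complex_of_real 1) = 1"
      using exp_eq_1[of ?b] by (auto simp: mult_ac)
    then show ?thesis
      by (simp add: G_def)
  qed
  also have "(\<lambda>x. indicator {0..1} x *\<^sub>R cis (2 * pi * real_of_int k * x)) = unit_wave k"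
    by (auto simp: fun_eq_iff unit_wave_def indicator_def)
  finally have "(LINT x|lborel. unit_wave k x) = 0" .
  moreover have "(LINT x|lebesgue. unit_wave k x) = (LINT x|lborel. unit_wave k x)"
  proof (rule integral_completion)
    have "integrable lborel (\<lambda>x. indicator {0..1} x *\<^sub>R cis (2 * pi * real_of_int k * x))"
      unfolding 1 by (intro borel_integrable_compact continuous_intros) auto
    then have "(\<lambda>x. indicator {0..1} x *\<^sub>R cis (2 * pi * real_of_int k * x)) \<in> borel_measurable lborel"
      by (rule borel_measurable_integrable)
    then show "unit_wave k \<in> borel_measurable lborel"
      by (rule measurable_cong[THEN iffD1, rotated -1]) (auto simp: indicator_def unit_wave_def)
  qed
  ultimately show ?thesis
    using False by simp
qed

lemma unit_wave_square_integrable: "unit_wave k \<in> square_integrable"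
  unfolding unit_wave_def
  by (intro square_integrable_indicator_continuous) (auto simp: cis_conv_exp intro!: continuous_intros)

lemma orthonormal_unit_wave: "orthonormal unit_wave"
proof -
  have "unit_wave k x * cnj (unit_wave l x) = unit_wave (k - l) x" for k l x
    by (auto simp: unit_wave_def indicator_def cis_cnj cis_mult algebra_simps)
  then show ?thesis
    by (simp add: orthonormal_def l2_inner_def unit_wave_square_integrable integral_unit_wave)
qed

lemma trig_poly_sum_unit_waves:
  assumes "trig_poly T"
  obtains F a where "finite F" "\<And>x. indicator {0..1} x * T x = (\<Sum>k\<in>F. a k * unit_wave k x)"
proof -
  have "\<exists>F a. finite F \<and> (\<forall>x. indicator {0..1} x * T x = (\<Sum>k\<in>F. a k * unit_wave k x))"
    using assms
  proof induction
    case (monomial a k)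
    show ?case
      by (rule exI[of _ "{k}"], rule exI[of _ "\<lambda>_. a"]) (simp add: unit_wave_def)
  next
    case (add f g)
    then obtain F a G b where F: "finite F" "\<And>x. indicator {0..1} x * f x = (\<Sum>k\<in>F. a k * unit_wave k x)"
      and G: "finite G" "\<And>x. indicator {0..1} x * g x = (\<Sum>k\<in>G. b k * unit_wave k x)"
      by blast
    let ?c = "\<lambda>k. (if k \<in> F then a k else 0) + (if k \<in> G then b k else 0)"
    have "indicator {0..1} x * (f x + g x) = (\<Sum>k\<in>F \<union> G. ?c k * unit_wave k x)" for x
    proof -
      have "(\<Sum>k\<in>F. a k * unit_wave k x) = (\<Sum>k\<in>F \<union> G. (if k \<in> F then a k else 0) * unit_wave k x)"
        using F(1) G(1) by (intro sum.mono_neutral_cong_left) auto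
      moreover have "(\<Sum>k\<in>G. b k * unit_wave k x) = (\<Sum>k\<in>F \<union> G. (if k \<in> G then b k else 0) * unit_wave k x)"
        using F(1) G(1) by (intro sum.mono_neutral_cong_left) auto
      ultimately show ?thesis
        by (simp add: distrib_left distrib_right F(2) G(2) sum.distrib)
    qed
    with F(1) G(1) show ?case
      by (intro exI[of _ "F \<union> G"] exI[of _ ?c]) auto
  qed
  then show ?thesis
    using that by (elim exE conjE) blast
qed

lemma Parseval_unit_interval:
  assumes f: "f \<in> square_integrable" and supp: "\<And>x. x \<notin> {0..1} \<Longrightarrow> f x = 0"
  shows "(\<integral>\<^sup>+k. ennreal ((cmod (l2_inner f (unit_wave k)))\<^sup>2) \<partial>count_space UNIV)
       = (\<integral>\<^sup>+x. ennreal ((cmod (f x))\<^sup>2) \<partial>lebesgue)"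
proof -
  have "((\<lambda>k. (cmod (l2_inner f (unit_wave k)))\<^sup>2) has_sum l2_sq f) UNIV"
  proof (rule orthonormal_Parseval[OF orthonormal_unit_wave f])
    fix \<epsilon> :: real assume "\<epsilon> > 0"
    then obtain T where T: "trig_poly T" "l2_sq (\<lambda>x. indicator {0..1} x * (f x - T x)) < \<epsilon>"
      using trig_approximable_square_integrable[OF f] unfolding trig_approximable_def by blast
    obtain F a where F: "finite F" "\<And>x. indicator {0..1} x * T x = (\<Sum>k\<in>F. a k * unit_wave k x)"
      using trig_poly_sum_unit_waves[OF T(1)] by blast
    have "(\<lambda>x. indicator {0..1} x * (f x - T x)) = (\<lambda>x. f x - (\<Sum>k\<in>F. a k * unit_wave k x))"
      using supp by (auto simp: fun_eq_iff F(2)[symmetric] indicator_def)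
    with T(2) F(1) show "\<exists>F a. finite F \<and> l2_sq (\<lambda>x. f x - (\<Sum>k\<in>F. a k * unit_wave k x)) < \<epsilon>"
      by auto
  qed
  then show ?thesis
    using nn_integral_count_space_eq_iff_has_sum[of "\<lambda>k. (cmod (l2_inner f (unit_wave k)))\<^sup>2" "l2_sq f"]
    by (simp add: l2_sq_nonneg nn_integral_square_integrable f)
qed

section \<open>Plancherel's theorem for compactly supported functions\<close>

lemma sigma_finite_lebesgue: "sigma_finite_measure (lebesgue :: real measure)"
proof
  show "\<exists>A::real set set. countable A \<and> A \<subseteq> sets lebesgue \<and> \<Union>A = space lebesgue \<and>
      (\<forall>a\<in>A. emeasure lebesgue a \<noteq> \<infinity>)"
  proof (intro exI[of _ "range (\<lambda>n::nat. {- real n..real n})"] conjI ballI)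
    have "\<exists>n. x \<in> {- real n..real n}" for x
      using real_arch_simple[of "\<bar>x\<bar>"] by (auto simp: abs_le_iff minus_le_iff)
    then show "\<Union> (range (\<lambda>n::nat. {- real n..real n})) = space lebesgue"
      by auto
  qed auto
qed

interpretation lebesgue: sigma_finite_measure "lebesgue :: real measure"
  by (rule sigma_finite_lebesgue)

interpretation lebesgue_pair: pair_sigma_finite "lebesgue :: real measure" "lebesgue :: real measure"
  by standard

lemma lebesgue_affine_real_measurable:
  "c \<noteq> 0 \<Longrightarrow> (\<lambda>x. t + c * x :: real) \<in> lebesgue \<rightarrow>\<^sub>M lebesgue"
  using lebesgue_affine_measurable[where c= "\<lambda>x::real. c"] by simp

lemma borel_measurable_affine_lebesgue:
  fixes f :: "real \<Rightarrow> 'b::topological_space"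
  assumes "f \<in> borel_measurable lebesgue" "c \<noteq> 0"
  shows "(\<lambda>x. f (t + c * x)) \<in> borel_measurable lebesgue"
  using measurable_compose[OF lebesgue_affine_real_measurable[OF assms(2)] assms(1)] .

lemma square_integrable_affine:
  assumes "f \<in> square_integrable" "c \<noteq> 0"
  shows "(\<lambda>x. f (t + c * x)) \<in> square_integrable"
  using assms lebesgue_integrable_real_affine[of "\<lambda>x. (cmod (f x))\<^sup>2" c t]
  by (auto simp: square_integrable_def intro: borel_measurable_affine_lebesgue)

lemma fourier_integral_eq:
  "fourier_integral f \<xi> = (LINT x|lebesgue. f x * cis (- (2 * pi * x * \<xi>)))"
  unfolding fourier_integral_def
  by (intro Bochner_Integration.integral_cong) (auto simp: cis_conv_exp mult_ac)

definition supported_within :: "real \<Rightarrow> (real \<Rightarrow> complex) \<Rightarrow> bool" where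
  "supported_within a f \<longleftrightarrow> (\<forall>x. a < \<bar>x\<bar> \<longrightarrow> f x = 0)"

lemma square_integrable_integrable_compact:
  assumes f: "f \<in> square_integrable" and supp: "supported_within a f"
  shows "integrable lebesgue f"
proof (rule Bochner_Integration.integrable_bound)
  show "integrable lebesgue (\<lambda>x. (cmod (f x))\<^sup>2 + indicator {-a..a} x)"
    using f by (intro Bochner_Integration.integrable_add square_integrable_integrable
        integrable_real_indicator) (auto simp: emeasure_lborel_Icc_eq)
  show "f \<in> borel_measurable lebesgue"
    using f by measurable
  show "AE x in lebesgue. norm (f x) \<le> norm ((cmod (f x))\<^sup>2 + indicator {-a..a} x)"
  proof (intro always_eventually allI)
    fix x
    show "norm (f x) \<le> norm ((cmod (f x))\<^sup>2 + indicator {-a..a} x)"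
    proof (cases "x \<in> {-a..a}")
      case True
      have "cmod (f x) \<le> (cmod (f x))\<^sup>2 + 1"
        using cmod_mult_le_sum_squares[of "f x" 1] by simp
      with True show ?thesis by simp
    next
      case False
      then have "a < \<bar>x\<bar>" by (auto simp: abs_if)
      with supp show ?thesis by (simp add: supported_within_def)
    qed
  qed
qed

lemma cis_measurable [measurable (raw)]:
  "f \<in> borel_measurable M \<Longrightarrow> (\<lambda>x. cis (f x)) \<in> borel_measurable M"
  by (rule borel_measurable_continuous_on[where f = cis])
     (auto simp: cis_conv_exp intro!: continuous_intros)

lemma id_borel_measurable_lebesgue [measurable]: "(\<lambda>x::real. x) \<in> borel_measurable lebesgue"
  by (intro measurable_completion) auto

lemma fourier_integral_measurable:
  assumes f [measurable]: "f \<in> borel_measurable lebesgue"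
  shows "fourier_integral f \<in> borel_measurable lebesgue"
proof -
  have [measurable]: "(\<lambda>z::real \<times> real. fst z) \<in> borel_measurable (lebesgue \<Otimes>\<^sub>M lebesgue)"
    "(\<lambda>z::real \<times> real. snd z) \<in> borel_measurable (lebesgue \<Otimes>\<^sub>M lebesgue)"
    by (rule measurable_compose[OF measurable_fst id_borel_measurable_lebesgue],
        rule measurable_compose[OF measurable_snd id_borel_measurable_lebesgue])
  have [measurable]: "(\<lambda>z. f (snd z)) \<in> borel_measurable (lebesgue \<Otimes>\<^sub>M lebesgue)"
    by (rule measurable_compose[OF measurable_snd f])
  have "(\<lambda>\<xi>. LINT x|lebesgue. f x * cis (- (2 * pi * x * \<xi>))) \<in> borel_measurable lebesgue"
    by (rule lebesgue.borel_measurable_lebesgue_integral) (simp add: case_prod_beta)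
  then show ?thesis
    by (simp add: fourier_integral_eq[abs_def])
qed

text \<open>
  By Tonelli, the right-hand side is the sum over \<open>k\<close> of the integrals of \<open>G\<close> over \<open>[k, k + 1)\<close>.
\<close>

lemma nn_integral_periodize:
  fixes G :: "real \<Rightarrow> ennreal"
  assumes G [measurable]: "G \<in> borel_measurable lebesgue"
  shows "(\<integral>\<^sup>+x. G x \<partial>lebesgue)
    = (\<integral>\<^sup>+x. indicator {0..<1} x * (\<integral>\<^sup>+k. G (x + real_of_int k) \<partial>count_space UNIV) \<partial>lebesgue)"
proof -
  have shift [measurable]: "(\<lambda>x. G (x + t)) \<in> borel_measurable lebesgue" for t
    using borel_measurable_affine_lebesgue[OF G, of 1 t] by (simp add: add.commute)
  have ind: "indicator {0..<1} (x - real_of_int k) = (indicator {\<lfloor>x\<rfloor>} k :: ennreal)" for x k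
    by (auto simp: indicator_def floor_eq_iff) linarith+
  have "(\<integral>\<^sup>+x. indicator {0..<1} x * (\<integral>\<^sup>+k. G (x + real_of_int k) \<partial>count_space UNIV) \<partial>lebesgue)
      = (\<integral>\<^sup>+x. \<integral>\<^sup>+k. indicator {0..<1} x * G (x + real_of_int k) \<partial>count_space UNIV \<partial>lebesgue)"
    by (simp add: nn_integral_cmult)
  also have "\<dots> = (\<integral>\<^sup>+k. \<integral>\<^sup>+x. indicator {0..<1} x * G (x + real_of_int k) \<partial>lebesgue \<partial>count_space UNIV)"
    by (rule nn_integral_count_space_nn_integral) auto
  also have "\<dots> = (\<integral>\<^sup>+k. \<integral>\<^sup>+x. indicator {\<lfloor>x\<rfloor>} k * G x \<partial>lebesgue \<partial>count_space UNIV)"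
  proof (rule nn_integral_cong)
    fix k :: int
    have [measurable]: "(\<lambda>x::real. indicator {\<lfloor>x\<rfloor>} k :: ennreal) \<in> borel_measurable lebesgue"
      unfolding ind[symmetric] by measurable
    have "(\<integral>\<^sup>+x. indicator {\<lfloor>x\<rfloor>} k * G x \<partial>lebesgue)
        = (\<integral>\<^sup>+x. indicator {\<lfloor>real_of_int k + 1 * x\<rfloor>} k * G (real_of_int k + 1 * x) \<partial>lebesgue)"
      by (subst nn_integral_real_affine_lebesgue[where c = 1 and t = "real_of_int k"]) auto
    also have "\<dots> = (\<integral>\<^sup>+x. indicator {0..<1} x * G (x + real_of_int k) \<partial>lebesgue)"
      using ind[of "real_of_int k + _" k] by (simp add: add.commute)
    finally show "(\<integral>\<^sup>+x. indicator {0..<1} x * G (x + real_of_int k) \<partial>lebesgue)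
        = (\<integral>\<^sup>+x. indicator {\<lfloor>x\<rfloor>} k * G x \<partial>lebesgue)" ..
  qed
  also have "\<dots> = (\<integral>\<^sup>+x. \<integral>\<^sup>+k. indicator {\<lfloor>x\<rfloor>} k * G x \<partial>count_space UNIV \<partial>lebesgue)"
  proof (rule nn_integral_count_space_nn_integral[symmetric])
    show "(\<lambda>x. indicator {\<lfloor>x\<rfloor>} k * G x) \<in> borel_measurable lebesgue" for k :: int
      unfolding ind[symmetric] by measurable
  qed auto
  also have "\<dots> = (\<integral>\<^sup>+x. G x \<partial>lebesgue)"
    by (intro nn_integral_cong) (simp add: nn_integral_multc)
  finally show ?thesis ..
qed

text \<open>
  For fixed \<open>\<xi>\<close> the values of the Fourier integral at the points \<open>\<xi> + k\<close> are the Fourier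
  coefficients of \<open>cis (- 2 \<pi> x \<xi>) f x\<close>.  By Parseval the sum of their squares is \<open>\<parallel>f\<parallel>\<^sup>2\<close> whatever
  \<open>\<xi>\<close> is, and integrating over a period \<open>0 \<le> \<xi> < 1\<close> covers the line exactly once.
\<close>

lemma Plancherel_unit_interval:
  assumes f: "f \<in> square_integrable" and supp: "\<And>x. x \<notin> {0..1} \<Longrightarrow> f x = 0"
  shows "(\<integral>\<^sup>+\<xi>. ennreal ((cmod (fourier_integral f \<xi>))\<^sup>2) \<partial>lebesgue)
       = (\<integral>\<^sup>+x. ennreal ((cmod (f x))\<^sup>2) \<partial>lebesgue)" (is "_ = ?N")
proof -
  let ?F = "\<lambda>\<xi>. ennreal ((cmod (fourier_integral f \<xi>))\<^sup>2)"
  have F [measurable]: "fourier_integral f \<in> borel_measurable lebesgue"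
    by (intro fourier_integral_measurable square_integrable_measurable f)
  have "(\<integral>\<^sup>+k. ?F (\<xi> + real_of_int k) \<partial>count_space UNIV) = ?N" for \<xi>
  proof -
    let ?h = "\<lambda>x. cis (- (2 * pi * x * \<xi>)) * f x"
    have h: "?h \<in> square_integrable"
      by (rule square_integrable_mult_bounded[OF f, where B = 1]) auto
    have "l2_inner ?h (unit_wave k) = fourier_integral f (\<xi> + real_of_int k)" for k
      unfolding l2_inner_def fourier_integral_eq
    proof (intro Bochner_Integration.integral_cong refl)
      fix x
      show "?h x * cnj (unit_wave k x) = f x * cis (- (2 * pi * x * (\<xi> + real_of_int k)))"
        using supp[of x]
        by (cases "x \<in> {0..1}") (auto simp: unit_wave_def cis_cnj cis_mult algebra_simps)
    qed
    then show ?thesis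
      using Parseval_unit_interval[OF h] supp by (simp add: norm_mult)
  qed
  then have "(\<integral>\<^sup>+\<xi>. ?F \<xi> \<partial>lebesgue) = (\<integral>\<^sup>+\<xi>. indicator {0..<1::real} \<xi> * ?N \<partial>lebesgue)"
    by (subst nn_integral_periodize) simp_all
  also have "\<dots> = ?N"
    by (simp add: nn_integral_multc)
  finally show ?thesis .
qed

text \<open>
  An affine change of variables carries \<open>[-b, b]\<close> to the unit interval.  It dilates the transform
  and multiplies it by a unimodular factor, and the Jacobian factors cancel.
\<close>

theorem Plancherel_compact_support:
  assumes f: "f \<in> square_integrable" and supp: "supported_within a f"
  shows "fourier_integral f \<in> square_integrable" "l2_sq (fourier_integral f) = l2_sq f"
proof -
  define b where "b = max a 1"
  have b: "b > 0" and supp: "f x = 0" if "b < \<bar>x\<bar>" for x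
    using supp that by (auto simp: b_def supported_within_def)
  then have b: "b > 0" by (simp add: b_def)
  define h where "h t = f (- b + 2 * b * t)" for t
  have h: "h \<in> square_integrable"
    unfolding h_def using f b by (intro square_integrable_affine) auto
  have h_supp: "h t = 0" if "t \<notin> {0..1}" for t
  proof -
    have "b < \<bar>- b + 2 * b * t\<bar>"
    proof (cases "t < 0")
      case True
      then have "b * t < 0" using b by (simp add: mult_pos_neg)
      with b show ?thesis by simp
    next
      case False
      with that have "b * 1 < b * t" using b by (intro mult_strict_left_mono) auto
      with b show ?thesis by simp
    qed
    with supp show ?thesis by (simp add: h_def)
  qed
  have F [measurable]: "fourier_integral f \<in> borel_measurable lebesgue"
    by (intro fourier_integral_measurable square_integrable_measurable f)
  have [measurable]: "fourier_integral h \<in> borel_measurable lebesgue"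
    by (intro fourier_integral_measurable square_integrable_measurable h)
  have h_Plancherel: "(\<integral>\<^sup>+\<xi>. ennreal ((cmod (fourier_integral h \<xi>))\<^sup>2) \<partial>lebesgue)
      = (\<integral>\<^sup>+x. ennreal ((cmod (h x))\<^sup>2) \<partial>lebesgue)"
    by (rule Plancherel_unit_interval[OF h]) (rule h_supp)
  have eq: "fourier_integral f (\<xi> / (2 * b)) = of_real (2 * b) * cis (pi * \<xi>) * fourier_integral h \<xi>" for \<xi>
  proof -
    have "fourier_integral f (\<xi> / (2 * b))
        = \<bar>2 * b\<bar> *\<^sub>R (LINT t|lebesgue. h t * cis (- (2 * pi * (- b + 2 * b * t) * (\<xi> / (2 * b)))))"
      unfolding fourier_integral_eq h_def using b
      by (intro lebesgue_integral_real_affine) auto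
    also have "(\<lambda>t. h t * cis (- (2 * pi * (- b + 2 * b * t) * (\<xi> / (2 * b)))))
        = (\<lambda>t. cis (pi * \<xi>) * (h t * cis (- (2 * pi * t * \<xi>))))"
    proof
      fix t
      have "- (2 * pi * (- b + 2 * b * t) * (\<xi> / (2 * b))) = pi * \<xi> + - (2 * pi * t * \<xi>)"
        using b by (simp add: field_simps)
      then show "h t * cis (- (2 * pi * (- b + 2 * b * t) * (\<xi> / (2 * b))))
          = cis (pi * \<xi>) * (h t * cis (- (2 * pi * t * \<xi>)))"
        by (simp only: cis_mult[symmetric] mult_ac)
    qed
    finally show ?thesis
      using b by (simp add: fourier_integral_eq scaleR_conv_of_real)
  qed
  have "(\<integral>\<^sup>+\<xi>. ennreal ((cmod (fourier_integral f \<xi>))\<^sup>2) \<partial>lebesgue)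
      = ennreal (1 / (2 * b)) * (\<integral>\<^sup>+\<xi>. ennreal ((cmod (fourier_integral f (\<xi> / (2 * b))))\<^sup>2) \<partial>lebesgue)"
    using b by (subst nn_integral_real_affine_lebesgue[where c = "1 / (2 * b)" and t = 0]) auto
  also have "\<dots> = ennreal (1 / (2 * b)) *
      (\<integral>\<^sup>+\<xi>. ennreal ((2 * b)\<^sup>2) * ennreal ((cmod (fourier_integral h \<xi>))\<^sup>2) \<partial>lebesgue)"
    unfolding eq by (simp add: norm_mult power_mult_distrib ennreal_mult)
  also have "\<dots> = ennreal (1 / (2 * b)) * (ennreal ((2 * b)\<^sup>2) *
      (\<integral>\<^sup>+x. ennreal ((cmod (h x))\<^sup>2) \<partial>lebesgue))"
    by (subst nn_integral_cmult) (auto simp: h_Plancherel)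
  also have "\<dots> = ennreal (2 * b) * (\<integral>\<^sup>+x. ennreal ((cmod (h x))\<^sup>2) \<partial>lebesgue)"
    using b by (simp add: mult.assoc[symmetric] ennreal_mult[symmetric] power2_eq_square)
  also have "\<dots> = (\<integral>\<^sup>+x. ennreal ((cmod (f x))\<^sup>2) \<partial>lebesgue)"
    using b f
    by (subst (2) nn_integral_real_affine_lebesgue[where c = "2 * b" and t = "- b"]) (auto simp: h_def)
  also have "\<dots> = ennreal (l2_sq f)"
    by (rule nn_integral_square_integrable[OF f])
  finally have *: "(\<integral>\<^sup>+\<xi>. ennreal ((cmod (fourier_integral f \<xi>))\<^sup>2) \<partial>lebesgue) = ennreal (l2_sq f)" .
  then show **: "fourier_integral f \<in> square_integrable"
    by (intro square_integrable_if_nn_integral_finite) auto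
  from * show "l2_sq (fourier_integral f) = l2_sq f"
    by (simp add: nn_integral_square_integrable[OF **] l2_sq_nonneg)
qed

section \<open>Fourier transforms in the mean\<close>

definition inverse_fourier :: "(real \<Rightarrow> complex) \<Rightarrow> real \<Rightarrow> complex" where
  "inverse_fourier h x = (LINT \<xi>|lebesgue. h \<xi> * cis (2 * pi * x * \<xi>))"

lemma inverse_fourier_eq: "inverse_fourier h x = fourier_integral h (- x)"
  by (simp add: inverse_fourier_def fourier_integral_eq mult_ac)

lemma inverse_fourier_Plancherel:
  assumes "h \<in> square_integrable" "supported_within a h"
  shows "inverse_fourier h \<in> square_integrable" "l2_sq (inverse_fourier h) = l2_sq h"
proof -
  note * = Plancherel_compact_support[OF assms]
  show "inverse_fourier h \<in> square_integrable"
    using square_integrable_affine[OF *(1), of "-1" 0] by (simp add: inverse_fourier_eq[abs_def])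
  have "l2_sq (fourier_integral h) = l2_sq (inverse_fourier h)"
    unfolding l2_sq_def inverse_fourier_eq
    by (subst lebesgue_integral_real_affine[where c = "-1" and t = 0]) auto
  with *(2) show "l2_sq (inverse_fourier h) = l2_sq h" by simp
qed

text \<open>
  Fubini's theorem.  Both functions are integrable because they have compact support, so the kernel
  is absolutely integrable on the plane.
\<close>

lemma fourier_integral_adjoint:
  assumes f: "f \<in> square_integrable" "supported_within a f"
    and h: "h \<in> square_integrable" "supported_within b h"
  shows "l2_inner (fourier_integral f) h = l2_inner f (inverse_fourier h)"
proof -
  note [measurable] = square_integrable_measurable[OF f(1)] square_integrable_measurable[OF h(1)]
  have fi: "integrable lebesgue f" and hi: "integrable lebesgue h"
    using f h by (auto intro: square_integrable_integrable_compact)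
  let ?k = "\<lambda>x \<xi>. f x * cis (- (2 * pi * x * \<xi>)) * cnj (h \<xi>)"
  have [measurable]: "(\<lambda>z::real \<times> real. fst z) \<in> borel_measurable (lebesgue \<Otimes>\<^sub>M lebesgue)"
    "(\<lambda>z::real \<times> real. snd z) \<in> borel_measurable (lebesgue \<Otimes>\<^sub>M lebesgue)"
    by (rule measurable_compose[OF measurable_fst id_borel_measurable_lebesgue],
        rule measurable_compose[OF measurable_snd id_borel_measurable_lebesgue])
  have [measurable]: "(\<lambda>z. f (fst z)) \<in> borel_measurable (lebesgue \<Otimes>\<^sub>M lebesgue)"
    "(\<lambda>z. h (snd z)) \<in> borel_measurable (lebesgue \<Otimes>\<^sub>M lebesgue)"
    by (rule measurable_compose[OF measurable_fst], simp, rule measurable_compose[OF measurable_snd], simp)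
  have int: "integrable (lebesgue \<Otimes>\<^sub>M lebesgue) (\<lambda>(x, \<xi>). ?k x \<xi>)"
  proof (rule lebesgue_pair.Fubini_integrable)
    show "(\<lambda>(x, \<xi>). ?k x \<xi>) \<in> borel_measurable (lebesgue \<Otimes>\<^sub>M lebesgue)"
      by (simp add: case_prod_beta)
    have "integrable lebesgue (\<lambda>x. norm (f x) * (LINT \<xi>|lebesgue. norm (h \<xi>)))"
      using fi by (intro integrable_mult_left integrable_norm)
    then show "integrable lebesgue (\<lambda>x. LINT \<xi>|lebesgue. norm (case (x, \<xi>) of (x, \<xi>) \<Rightarrow> ?k x \<xi>))"
      by (simp add: norm_mult)
    have "integrable lebesgue (\<lambda>\<xi>. ?k x \<xi>)" for x
    proof (rule Bochner_Integration.integrable_bound)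
      show "integrable lebesgue (\<lambda>\<xi>. f x * h \<xi>)"
        using hi by (rule integrable_mult_right)
    qed (auto simp: norm_mult)
    then show "AE x in lebesgue. integrable lebesgue (\<lambda>\<xi>. case (x, \<xi>) of (x, \<xi>) \<Rightarrow> ?k x \<xi>)"
      by simp
  qed
  have "l2_inner (fourier_integral f) h = (LINT \<xi>|lebesgue. LINT x|lebesgue. ?k x \<xi>)"
    unfolding l2_inner_def fourier_integral_eq by simp
  also have "\<dots> = (LINT x|lebesgue. LINT \<xi>|lebesgue. ?k x \<xi>)"
    by (rule lebesgue_pair.Fubini_integral[OF int])
  also have "\<dots> = (LINT x|lebesgue. f x * (LINT \<xi>|lebesgue. cnj (h \<xi> * cis (2 * pi * x * \<xi>))))"
    by (simp add: mult.assoc cis_cnj mult.commute[of "cnj _"])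
  also have "\<dots> = l2_inner f (inverse_fourier h)"
    unfolding l2_inner_def inverse_fourier_def by (subst Bochner_Integration.integral_cnj) simp
  finally show ?thesis .
qed

lemma truncation_square_integrable:
  "f \<in> square_integrable \<Longrightarrow> (\<lambda>x. indicator {- real n..real n} x * f x) \<in> square_integrable"
  by (rule square_integrable_indicator_mult) auto

lemma truncation_supported: "supported_within (real n) (\<lambda>x. indicator {- real n..real n} x * f x)"
  by (auto simp: supported_within_def indicator_def)

lemma truncation_tendsto:
  assumes f: "f \<in> square_integrable"
  shows "(\<lambda>n. l2_sq (\<lambda>x. indicator {- real n..real n} x * f x - f x)) \<longlonglongrightarrow> 0"
proof (rule l2_sq_dominated_tendsto_0)
  show "(\<lambda>x. indicator {- real n..real n} x * f x - f x) \<in> borel_measurable lebesgue" for n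
    by (intro square_integrable_measurable square_integrable_diff truncation_square_integrable f)
  show "integrable lebesgue (\<lambda>x. (cmod (f x))\<^sup>2)"
    by (rule square_integrable_integrable[OF f])
  show "(cmod (indicator {- real n..real n} x * f x - f x))\<^sup>2 \<le> (cmod (f x))\<^sup>2" for n x
    by (simp add: indicator_def)
  have "(\<lambda>n. indicator {- real n..real n} x * f x - f x) \<longlonglongrightarrow> 0" for x
  proof -
    obtain m :: nat where "\<bar>x\<bar> < real m"
      using reals_Archimedean2 by blast
    then have "eventually (\<lambda>n. indicator {- real n..real n} x * f x - f x = 0) sequentially"
      by (auto simp: eventually_sequentially indicator_def intro!: exI[of _ m])
    then show ?thesis
      by (rule tendsto_eventually)
  qed
  then show "AE x in lebesgue. (\<lambda>n. indicator {- real n..real n} x * f x - f x) \<longlonglongrightarrow> 0"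
    by simp
qed

lemma l2_inner_tendsto:
  assumes u: "\<And>n. u n \<in> square_integrable" and v: "v \<in> square_integrable" and w: "w \<in> square_integrable"
    and lim: "(\<lambda>n. l2_sq (\<lambda>x. u n x - v x)) \<longlonglongrightarrow> 0"
  shows "(\<lambda>n. l2_inner (u n) w) \<longlonglongrightarrow> l2_inner v w"
proof -
  have "(\<lambda>n. (cmod (l2_inner (u n) w - l2_inner v w))\<^sup>2) \<longlonglongrightarrow> 0"
  proof (rule tendsto_sandwich[OF _ _ tendsto_const])
    show "\<forall>\<^sub>F n in sequentially. (cmod (l2_inner (u n) w - l2_inner v w))\<^sup>2
        \<le> l2_sq (\<lambda>x. u n x - v x) * l2_sq w"
      using l2_Cauchy_Schwarz[OF square_integrable_diff[OF u v] w]
      by (simp add: l2_inner_diff_left u v w)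
    show "(\<lambda>n. l2_sq (\<lambda>x. u n x - v x) * l2_sq w) \<longlonglongrightarrow> 0"
      using tendsto_mult_right[OF lim, of "l2_sq w"] by simp
  qed auto
  then have "(\<lambda>n. sqrt ((cmod (l2_inner (u n) w - l2_inner v w))\<^sup>2)) \<longlonglongrightarrow> sqrt 0"
    by (rule tendsto_real_sqrt)
  then show ?thesis
    by (simp add: tendsto_norm_zero_iff LIM_zero_iff)
qed

lemma l2_sq_tendsto:
  assumes u: "\<And>n. u n \<in> square_integrable" and v: "v \<in> square_integrable"
    and lim: "(\<lambda>n. l2_sq (\<lambda>x. u n x - v x)) \<longlonglongrightarrow> 0"
  shows "(\<lambda>n. l2_sq (u n)) \<longlonglongrightarrow> l2_sq v"
proof -
  have "(\<lambda>n. Re (l2_inner (u n) v)) \<longlonglongrightarrow> l2_sq v"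
    using tendsto_Re[OF l2_inner_tendsto[OF u v v lim]] by (simp add: l2_inner_self)
  then have "(\<lambda>n. l2_sq (\<lambda>x. u n x - v x) + 2 * Re (l2_inner (u n) v) - l2_sq v)
      \<longlonglongrightarrow> 0 + 2 * l2_sq v - l2_sq v"
    by (intro tendsto_intros lim)
  then show ?thesis
    by (simp add: l2_sq_diff[OF u v])
qed

text \<open>
  All transforms of truncations are square integrable by Plancherel, so the convergence that defines
  the Fourier transform can be measured with the Bochner integral.
\<close>

lemma has_fourier_transform_iff:
  "has_fourier_transform f g \<longleftrightarrow> f \<in> square_integrable \<and> g \<in> square_integrable \<and>
     (\<lambda>n. l2_sq (\<lambda>\<xi>. fourier_integral (\<lambda>x. indicator {- real n..real n} x * f x) \<xi> - g \<xi>)) \<longlonglongrightarrow> 0"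
proof (cases "f \<in> square_integrable \<and> g \<in> square_integrable")
  case True
  then have "(\<lambda>\<xi>. fourier_integral (\<lambda>x. indicator {- real n..real n} x * f x) \<xi> - g \<xi>) \<in> square_integrable" for n
    using truncation_square_integrable truncation_supported
    by (intro square_integrable_diff Plancherel_compact_support(1)) auto
  then show ?thesis
    using True unfolding has_fourier_transform_def
    by (simp add: nn_integral_square_integrable ennreal_tendsto_0_iff l2_sq_nonneg)
qed (auto simp: has_fourier_transform_def)

text \<open>
  Fourier inversion.  Write \<open>\<psi>\<close> for the inverse transform of \<open>h\<close> and \<open>\<psi> n\<close> for its truncations.
  The adjoint identity gives \<open>\<langle>F (\<psi> n), h\<rangle> = \<langle>\<psi> n, \<psi>\<rangle> = \<parallel>\<psi> n\<parallel>\<^sup>2\<close>, and Plancherel gives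
  \<open>\<parallel>F (\<psi> n)\<parallel> = \<parallel>\<psi> n\<parallel>\<close>.  Hence \<open>\<parallel>F (\<psi> n) - h\<parallel>\<^sup>2 = \<parallel>h\<parallel>\<^sup>2 - \<parallel>\<psi> n\<parallel>\<^sup>2\<close>, which tends to
  \<open>\<parallel>h\<parallel>\<^sup>2 - \<parallel>\<psi>\<parallel>\<^sup>2 = 0\<close>.
\<close>

theorem has_fourier_transform_inverse_fourier:
  assumes h: "h \<in> square_integrable" and supp: "supported_within a h"
  shows "has_fourier_transform (inverse_fourier h) h"
proof -
  let ?\<psi> = "inverse_fourier h"
  let ?t = "\<lambda>n x. indicator {- real n..real n} x * ?\<psi> x"
  note \<psi> = inverse_fourier_Plancherel[OF h supp]
  have t: "?t n \<in> square_integrable" "supported_within (real n) (?t n)" for n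
    by (rule truncation_square_integrable[OF \<psi>(1)], rule truncation_supported)
  have "l2_sq (\<lambda>\<xi>. fourier_integral (?t n) \<xi> - h \<xi>) = l2_sq h - l2_sq (?t n)" for n
  proof -
    have "l2_inner (fourier_integral (?t n)) h = l2_inner (?t n) ?\<psi>"
      by (rule fourier_integral_adjoint[OF t h supp])
    also have "\<dots> = l2_inner (?t n) (?t n)"
      unfolding l2_inner_def by (intro Bochner_Integration.integral_cong) (auto simp: indicator_def)
    finally show ?thesis
      by (simp add: l2_sq_diff Plancherel_compact_support[OF t] h l2_inner_self)
  qed
  moreover have "(\<lambda>n. l2_sq h - l2_sq (?t n)) \<longlonglongrightarrow> l2_sq h - l2_sq ?\<psi>"
    by (intro tendsto_intros l2_sq_tendsto t \<psi> truncation_tendsto)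
  ultimately show ?thesis
    unfolding has_fourier_transform_iff using \<psi> h by simp
qed

text \<open>
  Both identities hold for the truncations of \<open>f\<close> and pass to the limit.
\<close>

theorem has_fourier_transform_Plancherel:
  assumes fg: "has_fourier_transform f g"
  shows "l2_sq f = l2_sq g"
    and "\<And>h. h \<in> square_integrable \<Longrightarrow> supported_within a h \<Longrightarrow>
      l2_inner f (inverse_fourier h) = l2_inner g h"
proof -
  let ?t = "\<lambda>n x. indicator {- real n..real n} x * f x"
  have f: "f \<in> square_integrable" and g: "g \<in> square_integrable"
    and lim: "(\<lambda>n. l2_sq (\<lambda>\<xi>. fourier_integral (?t n) \<xi> - g \<xi>)) \<longlonglongrightarrow> 0"
    using fg unfolding has_fourier_transform_iff by auto
  have t: "?t n \<in> square_integrable" "supported_within (real n) (?t n)" for n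
    by (rule truncation_square_integrable[OF f], rule truncation_supported)
  note Ft = Plancherel_compact_support[OF t]
  note t_lim = truncation_tendsto[OF f]
  show "l2_sq f = l2_sq g"
    using l2_sq_tendsto[OF t(1) f t_lim] l2_sq_tendsto[OF Ft(1) g lim] LIMSEQ_unique
    by (auto simp: Ft(2))
  show "l2_inner f (inverse_fourier h) = l2_inner g h"
    if h: "h \<in> square_integrable" "supported_within a h" for h
    using l2_inner_tendsto[OF t(1) f inverse_fourier_Plancherel(1)[OF h] t_lim]
      l2_inner_tendsto[OF Ft(1) g h(1) lim] LIMSEQ_unique
    by (auto simp: fourier_integral_adjoint[OF t h])
qed

section \<open>Sets that tile by translations and by dilations\<close>

definition integer_translation_tile :: "real set \<Rightarrow> bool" where
  "integer_translation_tile K \<longleftrightarrow> (AE x in lebesgue. \<exists>!m::int. x + real_of_int m \<in> K)"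

definition dyadic_dilation_tile :: "real set \<Rightarrow> bool" where
  "dyadic_dilation_tile K \<longleftrightarrow> (AE x in lebesgue. 0 < x \<longrightarrow> (\<exists>!j::int. 2 powi j * x \<in> K))"

lemma nn_integral_count_space_single:
  assumes "\<And>j. j \<noteq> i \<Longrightarrow> f j = 0"
  shows "(\<integral>\<^sup>+j. f j \<partial>count_space UNIV) = f i"
proof -
  have "(\<integral>\<^sup>+j. f j \<partial>count_space UNIV) = (\<integral>\<^sup>+j. f i * indicator {i} j \<partial>count_space UNIV)"
    using assms by (intro nn_integral_cong) (auto simp: indicator_def)
  then show ?thesis
    by (simp add: nn_integral_cmult)
qed

text \<open>
  Periodizing \<open>g\<close> produces a function \<open>G\<close> on the unit interval.  The integer translates of the tile
  do not overlap, so at almost every point at most one summand of \<open>G\<close> is nonzero; therefore \<open>G\<close> has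
  the same norm as \<open>g\<close>.  It has the same Fourier coefficients because \<open>cis (2 \<pi> k x)\<close> has period one.
  The bounded support of \<open>g\<close> makes the sum over the translates finite.
\<close>

lemma Parseval_translation_tile:
  assumes g: "g \<in> square_integrable" and supp: "supported_within a g"
    and gK: "\<And>x. x \<notin> K \<Longrightarrow> g x = 0" and K: "integer_translation_tile K"
  shows "(\<integral>\<^sup>+k. ennreal ((cmod (fourier_integral g (real_of_int k)))\<^sup>2) \<partial>count_space UNIV)
       = (\<integral>\<^sup>+x. ennreal ((cmod (g x))\<^sup>2) \<partial>lebesgue)"
proof -
  \<comment> \<open>The extra \<open>1\<close> accounts for the position of the base point in the unit interval.\<close>
  define N :: int where "N = \<lceil>a\<rceil> + 1"
  have N: "a + 1 \<le> real_of_int N"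
    by (simp add: N_def le_of_int_ceiling)
  define G where "G x = (\<Sum>m\<in>{-N..N}. indicator {0..<1} x * g (x + real_of_int m))" for x
  have shift: "(\<lambda>x. g (x + t)) \<in> square_integrable" for t
    using square_integrable_affine[OF g, of 1 t] by (simp add: add.commute)
  have Gm: "(\<lambda>x. indicator {0..<1} x * g (x + real_of_int m)) \<in> square_integrable" for m
    by (intro square_integrable_indicator_mult shift) auto
  have G: "G \<in> square_integrable"
    unfolding G_def by (intro square_integrable_sum Gm) auto
  have inN: "m \<in> {-N..N}" if "g (x + real_of_int m) \<noteq> 0" "x \<in> {0..<1}" for x m
  proof -
    have "\<bar>x + real_of_int m\<bar> \<le> a"
      using supp that(1) by (auto simp: supported_within_def not_less[symmetric])
    with N that(2) have "real_of_int m \<le> real_of_int N" "real_of_int (- N) \<le> real_of_int m"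
      by (auto simp: abs_le_iff)
    then show ?thesis
      unfolding of_int_le_iff by simp
  qed
  have inner: "l2_inner G (unit_wave k) = fourier_integral g (real_of_int k)" for k
  proof -
    let ?w = "\<lambda>x. cis (- (2 * pi * x * real_of_int k))"
    have int: "integrable lebesgue (\<lambda>x. indicator {\<lfloor>x\<rfloor>} m * (g x * ?w x))" for m :: int
    proof (rule Bochner_Integration.integrable_bound[OF square_integrable_integrable_compact[OF g supp]])
      have ind: "(indicator {\<lfloor>x\<rfloor>} m :: complex) = indicator {real_of_int m..<real_of_int m + 1} x" for x :: real
        by (auto simp: indicator_def floor_eq_iff) linarith+
      note [measurable] = square_integrable_measurable[OF g]
      show "(\<lambda>x. indicator {\<lfloor>x\<rfloor>} m * (g x * ?w x)) \<in> borel_measurable lebesgue"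
        unfolding ind by measurable
    qed (auto simp: norm_mult indicator_def)
    have "l2_inner G (unit_wave k)
        = (\<Sum>m\<in>{-N..N}. l2_inner (\<lambda>x. indicator {0..<1} x * g (x + real_of_int m)) (unit_wave k))"
      unfolding G_def by (intro l2_inner_sum_left Gm unit_wave_square_integrable) auto
    also have "\<dots> = (\<Sum>m\<in>{-N..N}. LINT x|lebesgue. indicator {\<lfloor>x\<rfloor>} m * (g x * ?w x))"
    proof (rule sum.cong[OF refl])
      fix m :: int
      have "(LINT x|lebesgue. indicator {\<lfloor>x\<rfloor>} m * (g x * ?w x))
          = \<bar>1\<bar> *\<^sub>R (LINT x|lebesgue. indicator {\<lfloor>real_of_int m + 1 * x\<rfloor>} m *
              (g (real_of_int m + 1 * x) * ?w (real_of_int m + 1 * x)))"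
        by (rule lebesgue_integral_real_affine) auto
      also have "\<dots> = l2_inner (\<lambda>x. indicator {0..<1} x * g (x + real_of_int m)) (unit_wave k)"
        unfolding l2_inner_def abs_one scaleR_one
      proof (rule Bochner_Integration.integral_cong[OF refl])
        fix x
        have "cis (- (2 * pi * (real_of_int m + 1 * x) * real_of_int k))
            = cis (2 * pi * real_of_int (- (m * k))) * ?w x"
          unfolding cis_mult by (simp add: algebra_simps)
        also have "cis (2 * pi * real_of_int (- (m * k))) = 1"
          by (intro cis_multiple_2pi) auto
        finally have w: "?w (real_of_int m + 1 * x) = ?w x"
          by simp
        have fl: "\<lfloor>real_of_int m + 1 * x\<rfloor> = m \<longleftrightarrow> x \<in> {0..<1}"
          by (auto simp: floor_eq_iff)
        show "indicator {\<lfloor>real_of_int m + 1 * x\<rfloor>} m * (g (real_of_int m + 1 * x) * ?w (real_of_int m + 1 * x))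
            = indicator {0..<1} x * g (x + real_of_int m) * cnj (unit_wave k x)"
          unfolding w using fl
          by (cases "x \<in> {0..<1}") (auto simp: unit_wave_def cis_cnj add.commute mult_ac indicator_def)
      qed
      finally show "l2_inner (\<lambda>x. indicator {0..<1} x * g (x + real_of_int m)) (unit_wave k)
          = (LINT x|lebesgue. indicator {\<lfloor>x\<rfloor>} m * (g x * ?w x))" ..
    qed
    also have "\<dots> = (LINT x|lebesgue. (\<Sum>m\<in>{-N..N}. indicator {\<lfloor>x\<rfloor>} m * (g x * ?w x)))"
      by (rule Bochner_Integration.integral_sum[symmetric]) (rule int)
    also have "\<dots> = (LINT x|lebesgue. g x * ?w x)"
    proof (rule Bochner_Integration.integral_cong[OF refl])
      fix x
      show "(\<Sum>m\<in>{-N..N}. indicator {\<lfloor>x\<rfloor>} m * (g x * ?w x)) = g x * ?w x"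
      proof (cases "g x = 0")
        case False
        then have "\<lfloor>x\<rfloor> \<in> {-N..N}"
          using inN[of "frac x" "\<lfloor>x\<rfloor>"] frac_lt_1[of x] by (simp add: frac_def)
        then show ?thesis
          by (simp add: indicator_def of_bool_def if_distrib[of "\<lambda>t. t * _"] cong: if_cong)
      qed simp
    qed
    also have "\<dots> = fourier_integral g (real_of_int k)"
      by (simp add: fourier_integral_eq)
    finally show ?thesis .
  qed
  have "AE x in lebesgue. ennreal ((cmod (G x))\<^sup>2)
      = indicator {0..<1} x * (\<integral>\<^sup>+m. ennreal ((cmod (g (x + real_of_int m)))\<^sup>2) \<partial>count_space UNIV)"
    using K unfolding integer_translation_tile_def
  proof eventually_elim
    case (elim x)
    show ?case
    proof (cases "x \<in> {0..<1}")
      case True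
      from elim obtain m0 :: int where m0: "\<And>m. m \<noteq> m0 \<Longrightarrow> x + real_of_int m \<notin> K"
        by blast
      then have zero: "g (x + real_of_int m) = 0" if "m \<noteq> m0" for m
        using that gK by blast
      have "G x = (\<Sum>m\<in>{-N..N}. if m = m0 then g (x + real_of_int m0) else 0)"
        unfolding G_def using True zero by (intro sum.cong) auto
      also have "\<dots> = g (x + real_of_int m0)"
        using inN[of x m0] True by auto
      finally have "G x = g (x + real_of_int m0)" .
      moreover have "(\<integral>\<^sup>+m. ennreal ((cmod (g (x + real_of_int m)))\<^sup>2) \<partial>count_space UNIV)
          = ennreal ((cmod (g (x + real_of_int m0)))\<^sup>2)"
        by (rule nn_integral_count_space_single) (simp add: zero)
      ultimately show ?thesis
        using True by simp
    qed (simp add: G_def)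
  qed
  then have "(\<integral>\<^sup>+x. ennreal ((cmod (G x))\<^sup>2) \<partial>lebesgue) = (\<integral>\<^sup>+x. indicator {0..<1} x *
      (\<integral>\<^sup>+m. ennreal ((cmod (g (x + real_of_int m)))\<^sup>2) \<partial>count_space UNIV) \<partial>lebesgue)"
    by (rule nn_integral_cong_AE)
  also have "\<dots> = (\<integral>\<^sup>+x. ennreal ((cmod (g x))\<^sup>2) \<partial>lebesgue)"
    using square_integrable_measurable[OF g]
    by (intro nn_integral_periodize[symmetric, where G = "\<lambda>x. ennreal ((cmod (g x))\<^sup>2)"]) measurable
  finally have "(\<integral>\<^sup>+x. ennreal ((cmod (G x))\<^sup>2) \<partial>lebesgue) = (\<integral>\<^sup>+x. ennreal ((cmod (g x))\<^sup>2) \<partial>lebesgue)" .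
  moreover have "(\<integral>\<^sup>+k. ennreal ((cmod (l2_inner G (unit_wave k)))\<^sup>2) \<partial>count_space UNIV)
       = (\<integral>\<^sup>+x. ennreal ((cmod (G x))\<^sup>2) \<partial>lebesgue)"
    by (rule Parseval_unit_interval[OF G]) (auto simp: G_def)
  ultimately show ?thesis
    by (simp add: inner)
qed

text \<open>
  Periodizing the indicator of a tile gives the constant \<open>1\<close> almost everywhere.
\<close>

lemma emeasure_translation_tile:
  assumes [measurable]: "K \<in> sets lebesgue" and K: "integer_translation_tile K"
  shows "emeasure lebesgue K = 1"
proof -
  have "emeasure lebesgue K = (\<integral>\<^sup>+x. indicator K x \<partial>lebesgue)"
    by simp
  also have "\<dots> = (\<integral>\<^sup>+x. indicator {0..<1} x *
      (\<integral>\<^sup>+m. indicator K (x + real_of_int m) \<partial>count_space UNIV) \<partial>lebesgue)"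
    by (rule nn_integral_periodize) auto
  also have "\<dots> = (\<integral>\<^sup>+x. indicator {0..<1::real} x \<partial>lebesgue)"
  proof (rule nn_integral_cong_AE)
    show "AE x in lebesgue. indicator {0..<1} x *
        (\<integral>\<^sup>+m. indicator K (x + real_of_int m) \<partial>count_space UNIV) = (indicator {0..<1} x :: ennreal)"
      using K unfolding integer_translation_tile_def
    proof eventually_elim
      case (elim x)
      then obtain m0 :: int where m0: "x + real_of_int m0 \<in> K" "\<And>m. m \<noteq> m0 \<Longrightarrow> x + real_of_int m \<notin> K"
        by blast
      have "(\<integral>\<^sup>+m. indicator K (x + real_of_int m) \<partial>count_space UNIV) = (indicator K (x + real_of_int m0) :: ennreal)"
        by (rule nn_integral_count_space_single) (simp add: m0)
      with m0(1) show ?case by simp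
    qed
  qed
  also have "\<dots> = 1"
    by simp
  finally show ?thesis .
qed

section \<open>Wavelets from tilings of the frequency line\<close>

text \<open>
  The Fourier transforms of the wavelets generated by the function whose transform is the indicator
  of \<open>K\<close>.
\<close>

definition wavelet_frequency :: "real set \<Rightarrow> int \<times> int \<Rightarrow> real \<Rightarrow> complex" where
  "wavelet_frequency K = (\<lambda>(j, k) \<xi>. complex_of_real (2 powr (- real_of_int j / 2)) *
     (cis (- (2 * pi * real_of_int k * (2 powi (- j) * \<xi>))) * indicator K (2 powi (- j) * \<xi>)))"

lemma dyadic_norm: "(2 powr (real_of_int j / 2))\<^sup>2 = 2 powi j"
  by (simp add: powr_power powr_real_of_int')

lemma dyadic_powr: "2 powi j * 2 powr (- real_of_int j / 2) = (2 powr (real_of_int j / 2) :: real)"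
  by (simp add: powr_real_of_int'[symmetric] powr_add[symmetric])

lemma dyadic_inverse: "2 powi (- j) * (2 powi j * x) = (x :: real)"
  by (simp add: power_int_minus)

lemma wavelet_frequency_dilate:
  "wavelet_frequency K (j, k) (2 powi j * \<eta>) = complex_of_real (2 powr (- real_of_int j / 2)) *
     (cis (- (2 * pi * real_of_int k * \<eta>)) * indicator K \<eta>)"
  by (simp only: wavelet_frequency_def prod.case dyadic_inverse)

context
  fixes K :: "real set" and a :: real
  assumes K [measurable]: "K \<in> sets lebesgue" and K_bounds: "K \<subseteq> {0<..a}"
begin

lemma indicator_square_integrable: "(indicator K :: real \<Rightarrow> complex) \<in> square_integrable"
proof (rule square_integrableI_bound)
  show "integrable lebesgue (indicator {0..a} :: real \<Rightarrow> real)"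
    by (intro integrable_real_indicator) (auto simp: emeasure_lborel_Icc_eq)
  show "(cmod (indicator K x))\<^sup>2 \<le> indicator {0..a} x" for x
    using K_bounds by (auto simp: indicator_def)
qed simp

lemma wavelet_frequency_square_integrable: "wavelet_frequency K (j, k) \<in> square_integrable"
proof -
  have "(\<lambda>\<xi>. indicator K (0 + 2 powi (- j) * \<xi>)) \<in> square_integrable"
    by (rule square_integrable_affine[OF indicator_square_integrable]) simp
  then have "(\<lambda>\<xi>. cis (- (2 * pi * real_of_int k * (2 powi (- j) * \<xi>))) *
      indicator K (2 powi (- j) * \<xi>)) \<in> square_integrable"
    by (intro square_integrable_mult_bounded[where B = 1]) auto
  then show ?thesis
    unfolding wavelet_frequency_def prod.case by (rule square_integrable_cmult)
qed

lemma wavelet_frequency_supported: "supported_within (2 powi j * a) (wavelet_frequency K (j, k))"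
  unfolding supported_within_def
proof (intro allI impI)
  fix \<xi> :: real assume *: "2 powi j * a < \<bar>\<xi>\<bar>"
  have "2 powi (- j) * \<xi> \<notin> K"
  proof
    assume "2 powi (- j) * \<xi> \<in> K"
    then have "0 < 2 powi (- j) * \<xi>" "2 powi (- j) * \<xi> \<le> a"
      using K_bounds by auto
    then have "0 < \<xi>" "\<xi> \<le> 2 powi j * a"
      by (auto simp: power_int_minus zero_less_mult_iff field_simps)
    with * show False by simp
  qed
  then show "wavelet_frequency K (j, k) \<xi> = 0"
    by (simp add: wavelet_frequency_def)
qed

lemma wavelet_frequency_nonpos: "\<xi> \<le> 0 \<Longrightarrow> wavelet_frequency K (j, k) \<xi> = 0"
proof -
  assume "\<xi> \<le> 0"
  then have "2 powi (- j) * \<xi> \<le> 0"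
    by (intro mult_nonneg_nonpos) auto
  with K_bounds have "2 powi (- j) * \<xi> \<notin> K" by auto
  then show ?thesis
    by (simp add: wavelet_frequency_def)
qed

text \<open>
  Dilating by \<open>2\<^sup>j\<close> in space dilates by \<open>2\<^bsup>-j\<^esup>\<close> in frequency, and translating by \<open>k\<close> becomes a
  modulation.
\<close>

lemma wavelet_system_eq_inverse_fourier:
  "wavelet_system (inverse_fourier (indicator K)) (j, k) = inverse_fourier (wavelet_frequency K (j, k))"
proof
  fix x
  let ?s = "2 powi j :: real" and ?r = "2 powr (real_of_int j / 2) :: real"
  have s: "?s \<noteq> 0" by simp
  have "inverse_fourier (wavelet_frequency K (j, k)) x
      = \<bar>?s\<bar> *\<^sub>R (LINT \<eta>|lebesgue. wavelet_frequency K (j, k) (0 + ?s * \<eta>) * cis (2 * pi * x * (0 + ?s * \<eta>)))"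
    unfolding inverse_fourier_def by (rule lebesgue_integral_real_affine[OF s])
  also have "(\<lambda>\<eta>. wavelet_frequency K (j, k) (0 + ?s * \<eta>) * cis (2 * pi * x * (0 + ?s * \<eta>)))
      = (\<lambda>\<eta>. complex_of_real (2 powr (- real_of_int j / 2)) *
          (indicator K \<eta> * cis (2 * pi * (?s * x - real_of_int k) * \<eta>)))"
  proof
    fix \<eta>
    have "2 * pi * (?s * x - real_of_int k) * \<eta> = - (2 * pi * real_of_int k * \<eta>) + 2 * pi * x * (?s * \<eta>)"
      by (simp add: algebra_simps)
    then have "cis (2 * pi * (?s * x - real_of_int k) * \<eta>)
        = cis (- (2 * pi * real_of_int k * \<eta>)) * cis (2 * pi * x * (?s * \<eta>))"
      by (simp only: cis_mult)
    then show "wavelet_frequency K (j, k) (0 + ?s * \<eta>) * cis (2 * pi * x * (0 + ?s * \<eta>))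
      = complex_of_real (2 powr (- real_of_int j / 2)) *
          (indicator K \<eta> * cis (2 * pi * (?s * x - real_of_int k) * \<eta>))"
      unfolding add_0 wavelet_frequency_dilate by (simp only: mult_ac)
  qed
  also have "\<bar>?s\<bar> *\<^sub>R (LINT \<eta>|lebesgue. complex_of_real (2 powr (- real_of_int j / 2)) *
          (indicator K \<eta> * cis (2 * pi * (?s * x - real_of_int k) * \<eta>)))
      = complex_of_real (?s * 2 powr (- real_of_int j / 2)) *
          (LINT \<eta>|lebesgue. indicator K \<eta> * cis (2 * pi * (?s * x - real_of_int k) * \<eta>))"
    by (simp add: scaleR_conv_of_real)
  finally show "wavelet_system (inverse_fourier (indicator K)) (j, k) x
      = inverse_fourier (wavelet_frequency K (j, k)) x"
    unfolding dyadic_powr by (simp add: wavelet_system_def inverse_fourier_def)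
qed

text \<open>
  Rescaling by \<open>2\<^sup>j\<close> expresses the coefficients at scale \<open>j\<close> as Fourier coefficients of a function
  supported on \<open>K\<close>, to which Parseval's identity for translation tiles applies.
\<close>

lemma l2_inner_wavelet_frequency:
  "l2_inner g (wavelet_frequency K (j, k)) = complex_of_real (2 powr (real_of_int j / 2)) *
     fourier_integral (\<lambda>\<eta>. indicator K \<eta> * g (2 powi j * \<eta>)) (- real_of_int k)"
proof -
  let ?s = "2 powi j :: real" and ?r = "2 powr (real_of_int j / 2) :: real"
  have s: "?s \<noteq> 0" by simp
  have "l2_inner g (wavelet_frequency K (j, k))
      = \<bar>?s\<bar> *\<^sub>R (LINT \<eta>|lebesgue. g (0 + ?s * \<eta>) * cnj (wavelet_frequency K (j, k) (0 + ?s * \<eta>)))"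
    unfolding l2_inner_def by (rule lebesgue_integral_real_affine[OF s])
  also have "(\<lambda>\<eta>. g (0 + ?s * \<eta>) * cnj (wavelet_frequency K (j, k) (0 + ?s * \<eta>)))
      = (\<lambda>\<eta>. complex_of_real (2 powr (- real_of_int j / 2)) *
          (indicator K \<eta> * g (?s * \<eta>) * cis (- (2 * pi * \<eta> * (- real_of_int k)))))"
    unfolding add_0 wavelet_frequency_dilate
    by (rule ext) (auto simp: cis_cnj mult_ac indicator_def)
  also have "\<bar>?s\<bar> *\<^sub>R (LINT \<eta>|lebesgue. complex_of_real (2 powr (- real_of_int j / 2)) *
          (indicator K \<eta> * g (?s * \<eta>) * cis (- (2 * pi * \<eta> * (- real_of_int k)))))
      = complex_of_real (?s * 2 powr (- real_of_int j / 2)) *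
          fourier_integral (\<lambda>\<eta>. indicator K \<eta> * g (?s * \<eta>)) (- real_of_int k)"
    by (simp add: scaleR_conv_of_real fourier_integral_eq)
  finally show ?thesis
    unfolding dyadic_powr .
qed

context
  assumes trans: "integer_translation_tile K" and dil: "dyadic_dilation_tile K"
begin

text \<open>
  At a fixed scale the coefficients account for the part of \<open>g\<close> on the dilate \<open>2\<^sup>j K\<close>.
\<close>

lemma Parseval_one_scale:
  assumes g: "g \<in> square_integrable"
  shows "(\<integral>\<^sup>+k. ennreal ((cmod (l2_inner g (wavelet_frequency K (j, k))))\<^sup>2) \<partial>count_space UNIV)
    = (\<integral>\<^sup>+\<xi>. indicator K (2 powi (- j) * \<xi>) * ennreal ((cmod (g \<xi>))\<^sup>2) \<partial>lebesgue)"
proof -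
  let ?s = "2 powi j :: real"
  have s: "?s \<noteq> 0" by simp
  define h where "h \<eta> = indicator K \<eta> * g (?s * \<eta>)" for \<eta>
  have "(\<lambda>\<eta>. g (0 + ?s * \<eta>)) \<in> square_integrable"
    by (rule square_integrable_affine[OF g s])
  then have h: "h \<in> square_integrable"
    unfolding h_def by (intro square_integrable_indicator_mult K) simp
  have h_supp: "supported_within a h"
    using K_bounds by (auto simp: supported_within_def h_def indicator_def)
  note [measurable] = square_integrable_measurable[OF g]
  have "(\<integral>\<^sup>+k. ennreal ((cmod (l2_inner g (wavelet_frequency K (j, k))))\<^sup>2) \<partial>count_space UNIV)
      = (\<integral>\<^sup>+k. ennreal ?s * ennreal ((cmod (fourier_integral h (real_of_int (- k))))\<^sup>2) \<partial>count_space UNIV)"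
    unfolding l2_inner_wavelet_frequency h_def[symmetric]
    by (simp add: norm_mult power_mult_distrib dyadic_norm ennreal_mult)
  also have "\<dots> = ennreal ?s *
      (\<integral>\<^sup>+k. ennreal ((cmod (fourier_integral h (real_of_int (- k))))\<^sup>2) \<partial>count_space UNIV)"
    by (rule nn_integral_cmult) simp
  also have "(\<integral>\<^sup>+k. ennreal ((cmod (fourier_integral h (real_of_int (- k))))\<^sup>2) \<partial>count_space UNIV)
      = (\<integral>\<^sup>+k. ennreal ((cmod (fourier_integral h (real_of_int k)))\<^sup>2) \<partial>count_space UNIV)"
    by (rule nn_integral_bij_count_space[where g = uminus]) (auto intro: bij_betw_byWitness[where f' = uminus])
  also have "\<dots> = (\<integral>\<^sup>+x. ennreal ((cmod (h x))\<^sup>2) \<partial>lebesgue)"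
    by (rule Parseval_translation_tile[OF h h_supp _ trans]) (simp add: h_def)
  also have "ennreal ?s * \<dots> = ennreal \<bar>?s\<bar> *
      (\<integral>\<^sup>+\<eta>. indicator K (2 powi (- j) * (0 + ?s * \<eta>)) * ennreal ((cmod (g (0 + ?s * \<eta>)))\<^sup>2) \<partial>lebesgue)"
    unfolding add_0 dyadic_inverse
    by (intro arg_cong2[where f = "(*)"] nn_integral_cong) (auto simp: h_def indicator_def)
  also have "\<dots> = (\<integral>\<^sup>+\<xi>. indicator K (2 powi (- j) * \<xi>) * ennreal ((cmod (g \<xi>))\<^sup>2) \<partial>lebesgue)"
  proof (rule nn_integral_real_affine_lebesgue[symmetric, OF _ s])
    have "(\<lambda>\<xi>. indicator K (0 + 2 powi (- j) * \<xi>) :: ennreal) \<in> borel_measurable lebesgue"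
      by (rule borel_measurable_affine_lebesgue) auto
    then have [measurable]: "(\<lambda>\<xi>. indicator K (2 powi (- j) * \<xi>) :: ennreal) \<in> borel_measurable lebesgue"
      by simp
    show "(\<lambda>\<xi>. indicator K (2 powi (- j) * \<xi>) * ennreal ((cmod (g \<xi>))\<^sup>2)) \<in> borel_measurable lebesgue"
      by measurable
  qed
  finally show ?thesis .
qed

text \<open>
  The dilates of \<open>K\<close> partition the positive half-line up to a null set, so the contributions of the
  scales add up to the full norm of a function that vanishes on the negative half-line.
\<close>

lemma Parseval_wavelet_frequency:
  assumes g: "g \<in> square_integrable" and pos: "AE \<xi> in lebesgue. \<xi> \<le> 0 \<longrightarrow> g \<xi> = 0"
  shows "((\<lambda>i. (cmod (l2_inner g (wavelet_frequency K i)))\<^sup>2) has_sum l2_sq g) UNIV"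
proof -
  let ?c = "\<lambda>i. ennreal ((cmod (l2_inner g (wavelet_frequency K i)))\<^sup>2)"
  note [measurable] = square_integrable_measurable[OF g]
  have ind [measurable]: "(\<lambda>\<xi>. indicator K (2 powi (- j) * \<xi>) :: ennreal) \<in> borel_measurable lebesgue" for j
    using borel_measurable_affine_lebesgue[of "indicator K :: real \<Rightarrow> ennreal" "2 powi (- j)" 0] by simp
  have "(\<integral>\<^sup>+i. ?c i \<partial>count_space UNIV)
      = (\<integral>\<^sup>+j. \<integral>\<^sup>+k. ?c (j, k) \<partial>count_space UNIV \<partial>count_space UNIV)"
    by (rule nn_integral_fst_count_space[symmetric])
  also have "\<dots> = (\<integral>\<^sup>+j. \<integral>\<^sup>+\<xi>. indicator K (2 powi (- j) * \<xi>) * ennreal ((cmod (g \<xi>))\<^sup>2)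
      \<partial>lebesgue \<partial>count_space UNIV)"
    by (simp only: Parseval_one_scale[OF g])
  also have "\<dots> = (\<integral>\<^sup>+\<xi>. \<integral>\<^sup>+j. indicator K (2 powi (- j) * \<xi>) * ennreal ((cmod (g \<xi>))\<^sup>2)
      \<partial>count_space UNIV \<partial>lebesgue)"
    by (rule nn_integral_count_space_nn_integral[symmetric]) auto
  also have "\<dots> = (\<integral>\<^sup>+\<xi>. ennreal ((cmod (g \<xi>))\<^sup>2) \<partial>lebesgue)"
  proof (rule nn_integral_cong_AE)
    show "AE \<xi> in lebesgue. (\<integral>\<^sup>+j. indicator K (2 powi (- j) * \<xi>) * ennreal ((cmod (g \<xi>))\<^sup>2)
      \<partial>count_space UNIV) = ennreal ((cmod (g \<xi>))\<^sup>2)"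
      using dil pos unfolding dyadic_dilation_tile_def
    proof eventually_elim
      case (elim \<xi>)
      show ?case
      proof (cases "0 < \<xi>")
        case True
        with elim(1) obtain j0 :: int where j0: "2 powi j0 * \<xi> \<in> K" "\<And>j. j \<noteq> j0 \<Longrightarrow> 2 powi j * \<xi> \<notin> K"
          by blast
        have "(\<integral>\<^sup>+j. indicator K (2 powi (- j) * \<xi>) * ennreal ((cmod (g \<xi>))\<^sup>2) \<partial>count_space UNIV)
            = indicator K (2 powi (- (- j0)) * \<xi>) * ennreal ((cmod (g \<xi>))\<^sup>2)"
        proof (rule nn_integral_count_space_single)
          fix j :: int assume "j \<noteq> - j0"
          then have "2 powi (- j) * \<xi> \<notin> K"
            by (intro j0(2)) auto
          then show "indicator K (2 powi (- j) * \<xi>) * ennreal ((cmod (g \<xi>))\<^sup>2) = 0"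
            by simp
        qed
        with j0(1) show ?thesis by simp
      next
        case False
        with elim(2) show ?thesis by simp
      qed
    qed
  qed
  also have "\<dots> = ennreal (l2_sq g)"
    by (rule nn_integral_square_integrable[OF g])
  finally show ?thesis
    using nn_integral_count_space_eq_iff_has_sum[of "\<lambda>i. (cmod (l2_inner g (wavelet_frequency K i)))\<^sup>2" "l2_sq g"]
    by (simp add: l2_sq_nonneg)
qed

lemma l2_sq_wavelet_frequency: "l2_sq (wavelet_frequency K (j, k)) = 1"
proof -
  let ?s = "2 powi j :: real"
  have s: "?s \<noteq> 0" by simp
  have "2 powr (- real_of_int j / 2) = (2 powr (real_of_int (- j) / 2) :: real)"
    by simp
  then have eq: "(cmod (wavelet_frequency K (j, k) (0 + ?s * \<eta>)))\<^sup>2 = indicator K \<eta> / ?s" for \<eta>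
    unfolding add_0 wavelet_frequency_dilate norm_mult power_mult_distrib norm_of_real power2_abs
    by (simp only: dyadic_norm) (auto simp: power_int_minus field_simps indicator_def)
  have "l2_sq (wavelet_frequency K (j, k))
      = \<bar>?s\<bar> *\<^sub>R (LINT \<eta>|lebesgue. (cmod (wavelet_frequency K (j, k) (0 + ?s * \<eta>)))\<^sup>2)"
    unfolding l2_sq_def by (rule lebesgue_integral_real_affine[OF s])
  also have "\<dots> = measure lebesgue K"
    unfolding eq by simp
  also have "\<dots> = 1"
    using emeasure_translation_tile[OF K trans] by (simp add: measure_def)
  finally show ?thesis .
qed

text \<open>
  Parseval's identity on the Hardy space and the unit norms of the wavelets suffice.  Applied to a
  wavelet \<open>e i\<close>, the identity says that \<open>1 = \<parallel>e i\<parallel>\<^sup>2\<close> is the sum of all \<open>|\<langle>e i, e l\<rangle>|\<^sup>2\<close>; the term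
  \<open>l = i\<close> already equals \<open>1\<close>, so all others vanish.  Once the wavelets are orthonormal, the identity
  says that the squared distance of \<open>f\<close> to its partial expansions tends to \<open>0\<close>.
\<close>

theorem H2_wavelet_set_if_tiles: "H2_wavelet_set K"
proof -
  let ?\<psi> = "inverse_fourier (indicator K)"
  let ?e = "wavelet_system ?\<psi>" and ?w = "wavelet_frequency K"
  have e: "?e i = inverse_fourier (?w i)" for i
    by (cases i) (simp only: wavelet_system_eq_inverse_fourier)
  have w: "?w i \<in> square_integrable" "\<exists>b. supported_within b (?w i)" for i
    by (cases i; use wavelet_frequency_square_integrable wavelet_frequency_supported in blast)+
  have ft: "has_fourier_transform (?e i) (?w i)" for i
    unfolding e using has_fourier_transform_inverse_fourier[OF w(1)[of i]] w(2)[of i] by blast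
  have e_sq: "?e i \<in> square_integrable" for i
    using ft by (simp add: has_fourier_transform_def)
  have e_hardy: "?e i \<in> hardy_space" for i
    using ft[of i] wavelet_frequency_nonpos e_sq
    by (cases i) (auto simp: hardy_space_def intro!: exI[of _ "?w i"])
  have norm_e: "l2_sq (?e i) = 1" for i
    using has_fourier_transform_Plancherel(1)[OF ft[of i]]
    by (cases i) (simp add: l2_sq_wavelet_frequency)
  have frame: "((\<lambda>i. (cmod (l2_inner f (?e i)))\<^sup>2) has_sum l2_sq f) UNIV" if f: "f \<in> hardy_space" for f
  proof -
    obtain g where g: "has_fourier_transform f g" "AE \<xi> in lebesgue. \<xi> \<le> 0 \<longrightarrow> g \<xi> = 0"
      using f by (auto simp: hardy_space_def)
    have "l2_inner f (?e i) = l2_inner g (?w i)" for i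
      using has_fourier_transform_Plancherel(2)[OF g(1)] w[of i] by (auto simp: e)
    moreover have "g \<in> square_integrable"
      using g(1) by (simp add: has_fourier_transform_def)
    ultimately show ?thesis
      using Parseval_wavelet_frequency[OF _ g(2)] has_fourier_transform_Plancherel(1)[OF g(1)] by simp
  qed
  have orth: "l2_inner (?e i) (?e i') = (if i = i' then 1 else 0)" for i i'
  proof (cases "i = i'")
    case True
    then show ?thesis by (simp add: l2_inner_self norm_e)
  next
    case False
    have "(\<Sum>l\<in>{i, i'}. (cmod (l2_inner (?e i) (?e l)))\<^sup>2) \<le> l2_sq (?e i)"
      by (rule finite_sum_le_has_sum[OF frame[OF e_hardy]]) auto
    then have "(cmod (l2_inner (?e i) (?e i')))\<^sup>2 \<le> 0"
      using False by (simp add: l2_inner_self norm_e)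
    then show ?thesis
      using False by simp
  qed
  then have onb: "orthonormal ?e"
    by (simp add: orthonormal_def e_sq)
  have complete: "\<exists>F c. finite F \<and> l2_norm (\<lambda>x. f x - (\<Sum>i\<in>F. c i * ?e i x)) < \<epsilon>"
    if f: "f \<in> hardy_space" and "\<epsilon> > 0" for f \<epsilon>
  proof -
    let ?c = "\<lambda>i. l2_inner f (?e i)"
    have "(sum (\<lambda>i. (cmod (?c i))\<^sup>2) \<longlongrightarrow> l2_sq f) (finite_subsets_at_top UNIV)"
      using frame[OF f] by (simp add: has_sum_def)
    then have "\<forall>\<^sub>F F in finite_subsets_at_top UNIV. l2_sq f - \<epsilon>\<^sup>2 < (\<Sum>i\<in>F. (cmod (?c i))\<^sup>2)"
      by (rule order_tendstoD) (use \<open>\<epsilon> > 0\<close> in simp)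
    then obtain F where F: "finite F" "l2_sq f - \<epsilon>\<^sup>2 < (\<Sum>i\<in>F. (cmod (?c i))\<^sup>2)"
      unfolding eventually_finite_subsets_at_top by blast
    have "f \<in> square_integrable"
      using f by (simp add: hardy_space_def)
    from l2_sq_diff_orthonormal_sum[OF onb this F(1), of ?c]
    have "l2_sq (\<lambda>x. f x - (\<Sum>i\<in>F. ?c i * ?e i x)) < \<epsilon>\<^sup>2"
      using F(2) by simp
    then have "l2_norm (\<lambda>x. f x - (\<Sum>i\<in>F. ?c i * ?e i x)) < \<epsilon>"
      unfolding l2_norm_eq using real_sqrt_less_mono \<open>\<epsilon> > 0\<close> by fastforce
    with F(1) show ?thesis
      by (intro exI conjI)
  qed
  have w00: "?w (0, 0) = indicator K"
    by (auto simp: fun_eq_iff wavelet_frequency_def)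
  have e00: "?e (0, 0) = ?\<psi>"
    by (simp add: e w00)
  have "H2_wavelet ?\<psi>"
    unfolding H2_wavelet_def orthonormal_basis_of_def
    using e_hardy e_hardy[of "(0, 0)"] orth complete unfolding e00 by blast
  moreover have "has_fourier_transform ?\<psi> (indicator K)"
    using ft[of "(0, 0)"] by (simp only: e00 w00)
  ultimately show ?thesis
    unfolding H2_wavelet_set_def using K K_bounds
    by (intro conjI exI[of _ ?\<psi>] exI[of _ "indicator K"]) (auto simp: indicator_def)
qed

end

end

lemma AE_lebesgue_not_in_countable:
  fixes D :: "real set" shows "countable D \<Longrightarrow> AE x in lebesgue. x \<notin> D"
  by (intro AE_not_in null_sets_completionI countable_imp_null_set_lborel)

section \<open>The four-interval set\<close>

context
  fixes c :: real
  assumes c: "1 / 2 < c" "c < 1"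
begin

abbreviation (input) "K\<^sub>c \<equiv> {1..2 * c} \<union> {2 * c + 2..c + 3} \<union> {c..(c + 1) / 2} \<union> {(c + 3) / 2..2}"

text \<open>
  Modulo \<open>1\<close> the pieces are \<open>[0, 2c - 1]\<close>, \<open>[2c - 1, c]\<close>, \<open>[c, (c + 1)/2]\<close> and \<open>[(c + 1)/2, 1]\<close>, after
  translation by \<open>-1\<close>, \<open>-3\<close>, \<open>0\<close> and \<open>-1\<close> respectively.  The translates of the endpoints form the
  null set that is left out.
\<close>

lemma translation_tile_K: "integer_translation_tile K\<^sub>c"
proof -
  let ?D = "(\<lambda>(d, m). d + real_of_int m) ` ({0, 2 * c - 1, c, (c + 1) / 2} \<times> UNIV)"
  have "AE x in lebesgue. x \<notin> ?D"
    by (intro AE_lebesgue_not_in_countable countable_image countable_SIGMA) auto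
  then show ?thesis
    unfolding integer_translation_tile_def
  proof eventually_elim
    case (elim x)
    define t where "t = x - real_of_int \<lfloor>x\<rfloor>"
    have t01: "0 \<le> t" "t < 1"
      unfolding t_def by linarith+
    have "t \<noteq> d" if "d \<in> {0, 2 * c - 1, c, (c + 1) / 2}" for d
    proof
      assume "t = d"
      then have "x = (\<lambda>(d, m). d + real_of_int m) (d, \<lfloor>x\<rfloor>)"
        by (simp add: t_def)
      with that elim show False by blast
    qed
    then have t: "t \<noteq> 0" "t \<noteq> 2 * c - 1" "t \<noteq> c" "t \<noteq> (c + 1) / 2"
      by auto
    have "\<exists>!m::int. t + real_of_int m \<in> K\<^sub>c"
    proof -
      \<comment> \<open>The inverse of the translation that carries the piece above \<open>t\<close> into the unit interval.\<close>
      define m0 :: int where "m0 = (if t < 2 * c - 1 then 1 else if t < c then 3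
        else if t < (c + 1) / 2 then 0 else 1)"
      have "t + real_of_int m0 \<in> K\<^sub>c"
        using t t01 c by (auto simp: m0_def field_simps)
      moreover have "m = m0" if "t + real_of_int m \<in> K\<^sub>c" for m
      proof -
        \<comment> \<open>The whole set lies between \<open>1/2\<close> and \<open>4\<close>, which leaves four translations to compare.\<close>
        have "-1 < real_of_int m" "real_of_int m < 4"
          using that t01 c by auto
        then have "m \<in> {0, 1, 2, 3}"
          by auto
        with that t t01 c show ?thesis
          by (auto simp: m0_def field_simps)
      qed
      ultimately show ?thesis by blast
    qed
    then obtain m0 where m0: "t + real_of_int m0 \<in> K\<^sub>c" "\<And>m. t + real_of_int m \<in> K\<^sub>c \<Longrightarrow> m = m0"
      by blast
    show ?case
    proof (rule ex1I)
      show "x + real_of_int (m0 - \<lfloor>x\<rfloor>) \<in> K\<^sub>c"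
        using m0(1) by (simp add: t_def algebra_simps)
      fix m assume "x + real_of_int m \<in> K\<^sub>c"
      then have "t + real_of_int (m + \<lfloor>x\<rfloor>) \<in> K\<^sub>c"
        by (simp add: t_def algebra_simps)
      from m0(2)[OF this] show "m = m0 - \<lfloor>x\<rfloor>" by simp
    qed
  qed
qed

text \<open>
  Dilation by \<open>1\<close>, \<open>1/2\<close>, \<open>2\<close> and \<open>1\<close> carries the pieces, in the order of their listing, to
  \<open>[1, 2c]\<close>, \<open>[c + 1, (c + 3)/2]\<close>, \<open>[2c, c + 1]\<close> and \<open>[(c + 3)/2, 2]\<close>, which together make up
  \<open>[1, 2]\<close>.  Again only the dilates of the endpoints are left out.
\<close>

lemma dilation_tile_K: "dyadic_dilation_tile K\<^sub>c"
proof -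
  let ?D = "(\<lambda>(d, j::int). 2 powi j * d) ` ({1, 2 * c, c + 1, (c + 3) / 2} \<times> UNIV)"
  have "AE x in lebesgue. x \<notin> ?D"
    by (intro AE_lebesgue_not_in_countable countable_image countable_SIGMA) auto
  then show ?thesis
    unfolding dyadic_dilation_tile_def
  proof eventually_elim
    case (elim x)
    show ?case
    proof
      assume "0 < x"
      define n where "n = \<lfloor>log 2 x\<rfloor>"
      define y where "y = 2 powi (- n) * x"
      have x: "x = 2 powi n * y"
        by (simp add: y_def power_int_minus)
      have y12: "1 \<le> y" "y < 2"
      proof -
        have "2 powr real_of_int n \<le> x" "x < 2 powr (real_of_int n + 1)"
          using \<open>0 < x\<close> unfolding n_def
          by (simp_all add: le_log_iff[symmetric] log_less_iff[symmetric])
        then have "2 powi n \<le> x" "x < 2 * 2 powi n"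
          by (simp_all add: powr_add powr_real_of_int')
        then show "1 \<le> y" "y < 2"
          by (simp_all add: y_def power_int_minus field_simps)
      qed
      have "y \<noteq> d" if "d \<in> {1, 2 * c, c + 1, (c + 3) / 2}" for d
      proof
        assume "y = d"
        then have "x = (\<lambda>(d, j). 2 powi j * d) (d, n)"
          by (simp add: x)
        with that elim show False by blast
      qed
      then have y: "y \<noteq> 1" "y \<noteq> 2 * c" "y \<noteq> c + 1" "y \<noteq> (c + 3) / 2"
        by auto
      have "\<exists>j0::int. 2 powi j0 * y \<in> K\<^sub>c \<and> (\<forall>j::int. 2 powi j * y \<in> K\<^sub>c \<longrightarrow> j = j0)"
      proof -
        \<comment> \<open>The inverse of the dilation that carries the piece containing \<open>y\<close> into \<open>[1, 2]\<close>.\<close>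
        define j0 :: int where "j0 = (if y < 2 * c then 0 else if y < c + 1 then -1
          else if y < (c + 3) / 2 then 1 else 0)"
        have "2 powi j0 * y \<in> K\<^sub>c"
          using y y12 c by (auto simp: j0_def power_int_minus field_simps)
        moreover have "j = j0" if j: "2 powi j * y \<in> K\<^sub>c" for j :: int
        proof -
          \<comment> \<open>The whole set lies between \<open>1/2\<close> and \<open>4\<close>, which leaves three dilations to compare.\<close>
          have "2 powi j * y < 4" "1 / 2 < 2 powi j * y"
            using j c by auto
          moreover have "2 powi j * 1 \<le> 2 powi j * y" "2 powi j * y < 2 powi j * 2"
            using y12 by (intro mult_left_mono mult_strict_left_mono; simp)+
          ultimately have "2 powi j < (4::real)" "(1 / 4::real) < 2 powi j"
            by linarith+
          then have "2 powi j < (2::real) powi 2" "(2::real) powi (- 2) < 2 powi j"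
            by (simp_all add: power_int_minus)
          then have "j < 2" "- 2 < j"
            using power_int_increasing[of 2 j "2::real"] power_int_increasing[of j "-2" "2::real"]
            by (auto simp: not_le[symmetric] simp del: not_le)
          then have "j \<in> {-1, 0, 1}"
            by auto
          with j y y12 c show ?thesis
            by (auto simp: j0_def power_int_minus field_simps)
        qed
        ultimately show ?thesis by blast
      qed
      then obtain j0 :: int where j0: "2 powi j0 * y \<in> K\<^sub>c" "\<And>j. 2 powi j * y \<in> K\<^sub>c \<Longrightarrow> j = j0"
        by blast
      have xy: "2 powi j * x = 2 powi (j + n) * y" for j
        by (simp add: x power_int_add)
      show "\<exists>!j::int. 2 powi j * x \<in> K\<^sub>c"
      proof (rule ex1I)
        show "2 powi (j0 - n) * x \<in> K\<^sub>c"
          unfolding xy using j0(1) by simp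
        fix j assume "2 powi j * x \<in> K\<^sub>c"
        then have "2 powi (j + n) * y \<in> K\<^sub>c"
          by (simp only: xy)
        from j0(2)[OF this] show "j = j0 - n" by simp
      qed
    qed
  qed
qed

end

theorem theorem15:
  fixes c :: real
  assumes "1 / 2 < c" and "c < 1"
  shows "H2_wavelet_set
    ({1..2 * c} \<union> {2 * c + 2..c + 3} \<union> {c..(c + 1) / 2} \<union> {(c + 3) / 2..2})"
proof (rule H2_wavelet_set_if_tiles)
  show "{1..2 * c} \<union> {2 * c + 2..c + 3} \<union> {c..(c + 1) / 2} \<union> {(c + 3) / 2..2} \<subseteq> {0<..c + 3}"
    using assms by auto
qed (use translation_tile_K[OF assms] dilation_tile_K[OF assms] in auto)

end
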